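(* Let $S$ be a semi-spray on $\mathbb{R}^n$ (a vector field on $T\mathbb{R}^n$), and let $D\subset T(T\mathbb{R}^n)$ be a distribution on $T\mathbb{R}^n$ that contains $S$. Suppose there exist a smooth two-form $\omega$ on $T\mathbb{R}^n$ and a closed one-form $\alpha$ on $T\mathbb{R}^n$ such that $$\alpha-i_S\omega\in D^\circ .$$ Then a function $H\in C^\infty(T\mathbb{R}^n)$ with $dH=\alpha$ is a constant of motion for $S$. Furthermore, if the distribution $D$ is integrable and $\omega$ is closed, then $$L=\{(X,\beta)\,|\,X\in D,\ \ \beta-i_X\omega\in D^\circ\}$$ is a Dirac structure on $T\mathbb{R}^n$ and $S$ is Hamiltonian with respect to $L$.
   Context: Coordinates $(x_1,\dots,x_n)$ on $\mathbb{R}^n$ induce coordinates $(x_1,\dots,x_n,y_1,\dots,y_n)$ on $T\mathbb{R}^n=\mathbb{R}^n\times\mathbb{R}^n$. A semi-spray on $\mathbb{R}^n$ is a vector field on $T\mathbb{R}^n$ of the form $S=\sum_{i=1}^n y_i\frac{\partial}{\partial x_i}-2\sum_{a=1}^n G^a(x,y)\frac{\partial}{\partial y_a}$ with $G^a$ smooth functions. A distribution is a smooth linear subbundle of the tangent bundle. For a distribution $D$, $D^\circ$ denotes its annihilator in the cotangent bundle, and $i_X\omega(Y)=\omega(X,Y)$. Membership such as $\alpha\in D^\circ$ or $X\in D$ means being a section. A constant of motion for $S$ is a function $H$ with $S(H)=0$. Dirac structures: on a manifold $M$, the bundle $\mathbb{T}M=TM\oplus T^*M$ carries the pairing $\langle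 (X,\alpha),(Y,\beta)\rangle=\beta(X)+\alpha(Y)$ and the Courant bracket $[\![(X,\alpha),(Y,\beta)]\!]=\big([X,Y],\ \mathcal{L}_X\beta-\mathcal{L}_Y\alpha+\tfrac12 d(\alpha(Y)-\beta(X))\big)$. A linear subbundle $L\subset\mathbb{T}M$ is an almost Dirac structure if $L=L^\perp$ with respect to the pairing, and a Dirac structure if moreover its sections are closed under the Courant bracket. A vector field $X$ is Hamiltonian with respect to $L$ if there is a smooth function $K$ such that $(X,dK)$ is a section of $L$. *)

theory Defs
  imports "HOL-Analysis.Analysis"
begin

text \<open>
  Tangent and cotangent spaces at every point of a Euclidean space \<open>'a\<close> are identified with \<open>'a\<close>
  and with \<open>'a \<Rightarrow>\<^sub>L real\<close>. Vector fields, one-forms and two-forms are thus functions on \<open>'a\<close> with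
  values in \<open>'a\<close>, \<open>'a \<Rightarrow>\<^sub>L real\<close> and \<open>'a \<Rightarrow>\<^sub>L 'a \<Rightarrow>\<^sub>L real\<close>, and a family of subspaces of a vector
  bundle with fibre \<open>'b\<close> is a function \<open>'a \<Rightarrow> 'b set\<close>.
\<close>

subsection \<open>Smooth maps, bundles and sections\<close>

primrec Ck_on :: "nat \<Rightarrow> 'a set \<Rightarrow> ('a::euclidean_space \<Rightarrow> 'b::real_normed_vector) \<Rightarrow> bool" where
  "Ck_on 0 U f \<longleftrightarrow> continuous_on U f"
| "Ck_on (Suc k) U f \<longleftrightarrow>
     (\<forall>x\<in>U. f differentiable (at x)) \<and> (\<forall>v. Ck_on k U (\<lambda>x. frechet_derivative f (at x) v))"

text \<open>Only meaningful for open \<open>U\<close>, since \<open>Ck_on\<close> takes derivatives in the whole space.\<close>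

definition smooth_on :: "'a set \<Rightarrow> ('a::euclidean_space \<Rightarrow> 'b::real_normed_vector) \<Rightarrow> bool" where
  "smooth_on U f \<longleftrightarrow> (\<forall>k. Ck_on k U f)"

abbreviation smooth :: "('a::euclidean_space \<Rightarrow> 'b::real_normed_vector) \<Rightarrow> bool" where
  "smooth \<equiv> smooth_on UNIV"

text \<open>Smooth linear subbundles have constant rank \<open>k\<close> and smooth local frames.\<close>

definition smooth_subbundle :: "('a::euclidean_space \<Rightarrow> 'b::real_normed_vector set) \<Rightarrow> bool" where
  "smooth_subbundle B \<longleftrightarrow> (\<exists>k::nat. \<forall>p. \<exists>U s. open U \<and> p \<in> U \<and>
     (\<forall>i<k. smooth_on U (s i)) \<and>
     (\<forall>q\<in>U. inj_on (\<lambda>i. s i q) {..<k} \<and> independent ((\<lambda>i. s i q) ` {..<k}) \<and>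
             span ((\<lambda>i. s i q) ` {..<k}) = B q))"

definition is_section ::
  "('a::euclidean_space \<Rightarrow> 'b::real_normed_vector set) \<Rightarrow> ('a \<Rightarrow> 'b) \<Rightarrow> bool" where
  "is_section B s \<longleftrightarrow> smooth s \<and> (\<forall>p. s p \<in> B p)"

abbreviation distribution :: "('a::euclidean_space \<Rightarrow> 'a set) \<Rightarrow> bool" where
  "distribution D \<equiv> smooth_subbundle D"

definition annihilator ::
  "('a::euclidean_space \<Rightarrow> 'a set) \<Rightarrow> 'a \<Rightarrow> ('a \<Rightarrow>\<^sub>L real) set" where
  "annihilator D p = {\<beta>. \<forall>v\<in>D p. blinfun_apply \<beta> v = 0}"

text \<open>
  \<open>integral_manifold D N\<close>: \<open>N\<close> is a submanifold with tangent spaces given by \<open>D\<close>. Near each of its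
  points \<open>N\<close> is flattened to an open piece of a linear subspace \<open>W\<close> by a diffeomorphism \<open>\<phi>\<close>, and the
  tangent space of \<open>N\<close> at \<open>r\<close> is the preimage of \<open>W\<close> under the derivative of \<open>\<phi>\<close> at \<open>r\<close>.
  For \<open>integrable_distribution\<close> embedded submanifolds suffice, as immersed ones are locally embedded.
\<close>

definition integral_manifold :: "('a::euclidean_space \<Rightarrow> 'a set) \<Rightarrow> 'a set \<Rightarrow> bool" where
  "integral_manifold D N \<longleftrightarrow> (\<forall>q\<in>N. \<exists>U V (\<phi> :: 'a \<Rightarrow> 'a) (\<psi> :: 'a \<Rightarrow> 'a) W.
     open U \<and> q \<in> U \<and> open V \<and> smooth_on U \<phi> \<and> smooth_on V \<psi> \<and> homeomorphism U V \<phi> \<psi> \<and>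
     subspace W \<and> \<phi> ` (N \<inter> U) = V \<inter> W \<and>
     (\<forall>r\<in>N \<inter> U. D r = {v. frechet_derivative \<phi> (at r) v \<in> W}))"

definition integrable_distribution :: "('a::euclidean_space \<Rightarrow> 'a set) \<Rightarrow> bool" where
  "integrable_distribution D \<longleftrightarrow> (\<forall>p. \<exists>N. p \<in> N \<and> integral_manifold D N)"

subsection \<open>Calculus of forms and vector fields\<close>

definition differential :: "('a::euclidean_space \<Rightarrow> real) \<Rightarrow> 'a \<Rightarrow> 'a \<Rightarrow>\<^sub>L real" where
  "differential H p = Blinfun (frechet_derivative H (at p))"

definition directional :: "('a::euclidean_space \<Rightarrow> 'a) \<Rightarrow> ('a \<Rightarrow> real) \<Rightarrow> 'a \<Rightarrow> real" where
  "directional X f p = frechet_derivative f (at p) (X p)"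

definition closed_one_form :: "('a::euclidean_space \<Rightarrow> 'a \<Rightarrow>\<^sub>L real) \<Rightarrow> bool" where
  "closed_one_form \<alpha> \<longleftrightarrow> smooth \<alpha> \<and>
     (\<forall>p u v. blinfun_apply (frechet_derivative \<alpha> (at p) u) v
            - blinfun_apply (frechet_derivative \<alpha> (at p) v) u = 0)"

definition two_form :: "('a::euclidean_space \<Rightarrow> 'a \<Rightarrow>\<^sub>L 'a \<Rightarrow>\<^sub>L real) \<Rightarrow> bool" where
  "two_form \<omega> \<longleftrightarrow> smooth \<omega> \<and> (\<forall>p v. blinfun_apply (blinfun_apply (\<omega> p) v) v = 0)"

text \<open>The cyclic sum is \<open>d\<omega>(u, v, w)\<close> evaluated on constant vector fields.\<close>

definition closed_two_form :: "('a::euclidean_space \<Rightarrow> 'a \<Rightarrow>\<^sub>L 'a \<Rightarrow>\<^sub>L real) \<Rightarrow> bool" where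
  "closed_two_form \<omega> \<longleftrightarrow> two_form \<omega> \<and>
     (\<forall>p u v w. blinfun_apply (blinfun_apply (frechet_derivative \<omega> (at p) u) v) w
              + blinfun_apply (blinfun_apply (frechet_derivative \<omega> (at p) v) w) u
              + blinfun_apply (blinfun_apply (frechet_derivative \<omega> (at p) w) u) v = 0)"

definition interior_product ::
  "('a::euclidean_space \<Rightarrow> 'a) \<Rightarrow> ('a \<Rightarrow> 'a \<Rightarrow>\<^sub>L 'a \<Rightarrow>\<^sub>L real) \<Rightarrow> 'a \<Rightarrow> 'a \<Rightarrow>\<^sub>L real" where
  "interior_product X \<omega> p = blinfun_apply (\<omega> p) (X p)"

definition lie_bracket :: "('a::euclidean_space \<Rightarrow> 'a) \<Rightarrow> ('a \<Rightarrow> 'a) \<Rightarrow> 'a \<Rightarrow> 'a" where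
  "lie_bracket X Y p = frechet_derivative Y (at p) (X p) - frechet_derivative X (at p) (Y p)"

text \<open>In coordinates \<open>(L\<^sub>X \<beta>)\<^sub>j = \<Sum>i. X\<^sub>i \<partial>\<^sub>i \<beta>\<^sub>j + \<beta>\<^sub>i \<partial>\<^sub>j X\<^sub>i\<close>.\<close>

definition lie_derivative ::
  "('a::euclidean_space \<Rightarrow> 'a) \<Rightarrow> ('a \<Rightarrow> 'a \<Rightarrow>\<^sub>L real) \<Rightarrow> 'a \<Rightarrow> 'a \<Rightarrow>\<^sub>L real" where
  "lie_derivative X \<beta> p = Blinfun (\<lambda>v.
     blinfun_apply (frechet_derivative \<beta> (at p) (X p)) v
     + blinfun_apply (\<beta> p) (frechet_derivative X (at p) v))"

subsection \<open>Dirac structures\<close>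

definition courant_pairing ::
  "'a::euclidean_space \<times> ('a \<Rightarrow>\<^sub>L real) \<Rightarrow> 'a \<times> ('a \<Rightarrow>\<^sub>L real) \<Rightarrow> real" where
  "courant_pairing a b = blinfun_apply (snd b) (fst a) + blinfun_apply (snd a) (fst b)"

definition courant_bracket ::
  "('a::euclidean_space \<Rightarrow> 'a \<times> ('a \<Rightarrow>\<^sub>L real)) \<Rightarrow> ('a \<Rightarrow> 'a \<times> ('a \<Rightarrow>\<^sub>L real))
     \<Rightarrow> 'a \<Rightarrow> 'a \<times> ('a \<Rightarrow>\<^sub>L real)" where
  "courant_bracket a b =
     (let X = fst \<circ> a; \<alpha> = snd \<circ> a; Y = fst \<circ> b; \<beta> = snd \<circ> b in
      (\<lambda>p. (lie_bracket X Y p,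
            lie_derivative X \<beta> p - lie_derivative Y \<alpha> p
            + (1/2) *\<^sub>R differential
                (\<lambda>q. blinfun_apply (\<alpha> q) (Y q) - blinfun_apply (\<beta> q) (X q)) p)))"

definition almost_dirac :: "('a::euclidean_space \<Rightarrow> ('a \<times> ('a \<Rightarrow>\<^sub>L real)) set) \<Rightarrow> bool" where
  "almost_dirac L \<longleftrightarrow> smooth_subbundle L \<and>
     (\<forall>p. L p = {a. \<forall>b\<in>L p. courant_pairing a b = 0})"

definition dirac_structure :: "('a::euclidean_space \<Rightarrow> ('a \<times> ('a \<Rightarrow>\<^sub>L real)) set) \<Rightarrow> bool" where
  "dirac_structure L \<longleftrightarrow> almost_dirac L \<and>
     (\<forall>a b. is_section L a \<and> is_section L b \<longrightarrow> is_section L (courant_bracket a b))"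

definition hamiltonian ::
  "('a::euclidean_space \<Rightarrow> ('a \<times> ('a \<Rightarrow>\<^sub>L real)) set) \<Rightarrow> ('a \<Rightarrow> 'a) \<Rightarrow> bool" where
  "hamiltonian L X \<longleftrightarrow> (\<exists>K. smooth K \<and> is_section L (\<lambda>p. (X p, differential K p)))"

definition dirac_of ::
  "('a::euclidean_space \<Rightarrow> 'a set) \<Rightarrow> ('a \<Rightarrow> 'a \<Rightarrow>\<^sub>L 'a \<Rightarrow>\<^sub>L real)
     \<Rightarrow> 'a \<Rightarrow> ('a \<times> ('a \<Rightarrow>\<^sub>L real)) set" where
  "dirac_of D \<omega> p = {(v, \<beta>). v \<in> D p \<and> \<beta> - blinfun_apply (\<omega> p) v \<in> annihilator D p}"

subsection \<open>Semi-sprays\<close>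

text \<open>\<open>T\<real>\<^sup>n\<close> with coordinates \<open>(x, y)\<close>.\<close>

type_synonym 'n tangent_space = "(real ^ 'n) \<times> (real ^ 'n)"

definition semispray :: "('n::finite tangent_space \<Rightarrow> 'n tangent_space) \<Rightarrow> bool" where
  "semispray S \<longleftrightarrow> (\<exists>G :: 'n \<Rightarrow> 'n tangent_space \<Rightarrow> real. (\<forall>a. smooth (G a)) \<and>
     (\<forall>x y. S (x, y) = (y, \<chi> a. - 2 * G a (x, y))))"

definition constant_of_motion :: "('a::euclidean_space \<Rightarrow> 'a) \<Rightarrow> ('a \<Rightarrow> real) \<Rightarrow> bool" where
  "constant_of_motion S H \<longleftrightarrow> (\<forall>p. directional S H p = 0)"

end

theory Submission
  imports Defs
begin

text \<open>
  Contracting \<open>\<alpha> - i\<^sub>S\<omega> \<in> D\<^sup>\<circ>\<close> with \<open>S \<in> D\<close> gives \<open>\<alpha>(S) = 0\<close>, so a potential of \<open>\<alpha>\<close> is conserved. The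
  same hypothesis says that \<open>(S, \<alpha>)\<close> is a section of \<open>L\<close>, and \<open>\<alpha>\<close> has a potential by the Poincare
  lemma. For the bracket write sections of \<open>L\<close> as \<open>(X, i\<^sub>X\<omega> + \<theta>)\<close> and \<open>(Y, i\<^sub>Y\<omega> + \<tau>)\<close> with
  \<open>\<theta>, \<tau> \<in> D\<^sup>\<circ>\<close>. On \<open>D\<close> the one-form part of their bracket is \<open>i\<^sub>[\<^sub>X\<^sub>,\<^sub>Y\<^sub>]\<omega> + i\<^sub>Yi\<^sub>Xd\<omega> + i\<^sub>Xd\<tau> - i\<^sub>Yd\<theta>\<close>, where
  \<open>d\<omega> = 0\<close> and where \<open>d\<theta>\<close> and \<open>d\<tau>\<close> vanish on \<open>D\<close> because \<open>D\<close> is involutive.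
\<close>

subsection \<open>Calculus of smooth maps\<close>

text \<open>Integrability is given by integral manifolds, whereas closure under the bracket needs
  involutivity, so the elementary half of the Frobenius theorem has to be derived. Tangency to the
  manifold is written as \<open>d\<phi>(Z) \<in> W\<close> in a flattening chart and differentiated
  along the manifold in the directions of both fields; the second derivatives of \<phi> cancel by
  symmetry. A vector of D at p is extended only to a neighbourhood of p, which is why fields in this
  argument need to lie in D only near p. The other obstacle is that L must have constant rank and
  smooth local frames. An orthogonal frame whose first members span D settles this, since the inner
  products with the remaining members span the annihilator. Smoothness is defined through
  derivatives in fixed directions; derivatives in moving directions and operator-valued maps are
  reduced to these by expansion in a basis.\<close>

abbreviation fd :: "('a::real_normed_vector \<Rightarrow> 'b::real_normed_vector) \<Rightarrow> 'a \<Rightarrow> 'a \<Rightarrow> 'b" where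
  "fd f x \<equiv> frechet_derivative f (at x)"

text \<open>Since \<open>U\<close> is open, agreement on \<open>U\<close> is agreement near each of
  its points, so the derivatives, taken in the whole space, agree as well.\<close>

lemma Ck_on_cong:
  assumes "open U" "\<And>x. x \<in> U \<Longrightarrow> f x = g x" "Ck_on k U f"
  shows "Ck_on k U g"
  using assms(2,3)
proof (induction k arbitrary: f g)
  case 0
  then show ?case by (simp cong: continuous_on_cong)
next
  case (Suc k)
  have d: "(g has_derivative fd f x) (at x)" if "x \<in> U" for x
  proof (rule has_derivative_transform_within_open[OF _ \<open>open U\<close> that])
    show "(f has_derivative fd f x) (at x)"
      using Suc.prems(2) that by (simp add: frechet_derivative_works[symmetric])
  qed (use Suc.prems(1) in auto)
  have "Ck_on k U (\<lambda>x. fd g x v)" for v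
  proof (rule Suc.IH)
    show "fd f x v = fd g x v" if "x \<in> U" for x
      using frechet_derivative_at[OF d[OF that]] by simp
    show "Ck_on k U (\<lambda>x. fd f x v)"
      using Suc.prems(2) by simp
  qed
  moreover have "\<forall>x\<in>U. g differentiable (at x)"
    using d unfolding differentiable_def by blast
  ultimately show ?case by simp
qed

text \<open>Replaces the derivative picked by \<open>frechet_derivative\<close> with one given by a
  formula, so that the product and chain rules can supply it directly.\<close>

lemma Ck_on_Suc_intro:
  assumes "open U" "\<And>x. x \<in> U \<Longrightarrow> (f has_derivative f' x) (at x)"
    and "\<And>v. Ck_on k U (\<lambda>x. f' x v)"
  shows "Ck_on (Suc k) U f"
proof -
  have "f' x v = fd f x v" if "x \<in> U" for x v
    by (simp only: frechet_derivative_at[OF assms(2)[OF that]])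
  then have "Ck_on k U (\<lambda>x. fd f x v)" for v
    by (rule Ck_on_cong[OF assms(1) _ assms(3)[of v]])
  moreover have "\<forall>x\<in>U. f differentiable (at x)"
    using assms(2) unfolding differentiable_def by blast
  ultimately show ?thesis by simp
qed

lemma Ck_on_SucD: "Ck_on (Suc k) U f \<Longrightarrow> Ck_on k U f"
proof (induction k arbitrary: f)
  case 0
  then show ?case
    by (auto intro!: continuous_at_imp_continuous_on differentiable_imp_continuous_within)
next
  case (Suc k)
  have "Ck_on k U (\<lambda>x. fd f x v)" for v
    using Suc.prems by (intro Suc.IH) (simp only: Ck_on.simps(2)[of "Suc k"])
  moreover have "\<forall>x\<in>U. f differentiable (at x)"
    using Suc.prems unfolding Ck_on.simps(2)[of "Suc k"] by (rule conjunct1)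
  ultimately show ?case by simp
qed

lemma Ck_on_bounded_linear:
  assumes "bounded_linear h" "open U" "Ck_on k U f"
  shows "Ck_on k U (\<lambda>x. h (f x))"
  using assms(3)
proof (induction k arbitrary: f)
  case 0
  then show ?case using assms(1) by (simp add: bounded_linear.continuous_on)
next
  case (Suc k)
  show ?case
  proof (rule Ck_on_Suc_intro[OF assms(2)])
    show "((\<lambda>x. h (f x)) has_derivative (\<lambda>v. h (fd f x v))) (at x)" if "x \<in> U" for x
      using Suc.prems that
      by (intro bounded_linear.has_derivative[OF assms(1)])
         (auto simp: frechet_derivative_works[symmetric])
  qed (use Suc in auto)
qed

lemma Ck_on_add:
  assumes "open U" "Ck_on k U f" "Ck_on k U g"
  shows "Ck_on k U (\<lambda>x. f x + g x)"
  using assms(2,3)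
proof (induction k arbitrary: f g)
  case (Suc k)
  show ?case
  proof (rule Ck_on_Suc_intro[OF assms(1)])
    show "((\<lambda>x. f x + g x) has_derivative (\<lambda>v. fd f x v + fd g x v)) (at x)" if "x \<in> U" for x
      using Suc.prems that
      by (intro has_derivative_add) (auto simp: frechet_derivative_works[symmetric])
  qed (use Suc in auto)
qed (auto intro: continuous_intros)

text \<open>The product rule brings back the undifferentiated factors, but only at order
  \<open>k\<close>, where \<open>Ck_on_SucD\<close> and the induction hypothesis apply.\<close>

lemma Ck_on_bilinear:
  assumes "bounded_bilinear bl" "open U" "Ck_on k U f" "Ck_on k U g"
  shows "Ck_on k U (\<lambda>x. bl (f x) (g x))"
  using assms(3,4)
proof (induction k arbitrary: f g)
  case 0
  then show ?case using assms(1) by (simp add: bounded_bilinear.continuous_on)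
next
  case (Suc k)
  show ?case
  proof (rule Ck_on_Suc_intro[OF assms(2)])
    show "((\<lambda>x. bl (f x) (g x)) has_derivative
        (\<lambda>v. bl (f x) (fd g x v) + bl (fd f x v) (g x))) (at x)" if "x \<in> U" for x
      using Suc.prems that
      by (intro bounded_bilinear.FDERIV[OF assms(1)])
         (auto simp: frechet_derivative_works[symmetric])
    show "Ck_on k U (\<lambda>x. bl (f x) (fd g x v) + bl (fd f x v) (g x))" for v
      using Suc Suc.prems[THEN Ck_on_SucD] by (intro Ck_on_add[OF assms(2)] Suc.IH) auto
  qed
qed

lemma Ck_on_inverse:
  fixes f :: "'a::euclidean_space \<Rightarrow> real"
  assumes "open U" "Ck_on k U f" "\<And>x. x \<in> U \<Longrightarrow> f x \<noteq> 0"
  shows "Ck_on k U (\<lambda>x. inverse (f x))"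
  using assms(2)
proof (induction k)
  case 0
  then show ?case using assms(3) by (auto intro!: continuous_intros)
next
  case (Suc k)
  show ?case
  proof (rule Ck_on_Suc_intro[OF assms(1)])
    show "((\<lambda>x. inverse (f x)) has_derivative (\<lambda>v. - (inverse (f x) * fd f x v * inverse (f x)))) (at x)"
      if "x \<in> U" for x
      using Suc.prems that assms(3)[OF that]
      by (intro Deriv.has_derivative_inverse) (auto simp: frechet_derivative_works[symmetric])
    show "Ck_on k U (\<lambda>x. - (inverse (f x) * fd f x v * inverse (f x)))" for v
      using Suc.IH Suc.prems Ck_on_SucD[OF Suc.prems] assms(1)
      by (intro Ck_on_bounded_linear[OF bounded_linear_minus[OF bounded_linear_ident]]
          Ck_on_bilinear[OF bounded_bilinear_mult]) auto
  qed
qed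

lemma Ck_on_subset: "Ck_on k U f \<Longrightarrow> V \<subseteq> U \<Longrightarrow> Ck_on k V f"
  by (induction k arbitrary: f) (auto intro: continuous_on_subset)

lemma Ck_on_const: "Ck_on k U (\<lambda>x. c)"
  by (induction k arbitrary: c) auto

lemma smooth_on_cong:
  "open U \<Longrightarrow> (\<And>x. x \<in> U \<Longrightarrow> f x = g x) \<Longrightarrow> smooth_on U f \<Longrightarrow> smooth_on U g"
  unfolding smooth_on_def using Ck_on_cong by blast

lemma smooth_on_subset: "smooth_on U f \<Longrightarrow> V \<subseteq> U \<Longrightarrow> smooth_on V f"
  unfolding smooth_on_def using Ck_on_subset by blast

lemma smooth_on_const [simp]: "smooth_on U (\<lambda>x. c)"
  by (simp add: smooth_on_def Ck_on_const)

lemma smooth_on_bounded_linear: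
  "bounded_linear h \<Longrightarrow> open U \<Longrightarrow> smooth_on U f \<Longrightarrow> smooth_on U (\<lambda>x. h (f x))"
  unfolding smooth_on_def using Ck_on_bounded_linear by blast

lemma smooth_on_add:
  "open U \<Longrightarrow> smooth_on U f \<Longrightarrow> smooth_on U g \<Longrightarrow> smooth_on U (\<lambda>x. f x + g x)"
  unfolding smooth_on_def using Ck_on_add by blast

lemma smooth_on_diff:
  "open U \<Longrightarrow> smooth_on U f \<Longrightarrow> smooth_on U g \<Longrightarrow> smooth_on U (\<lambda>x. f x - g x)"
  using smooth_on_add[of U f "\<lambda>x. - g x"]
    smooth_on_bounded_linear[OF bounded_linear_minus[OF bounded_linear_ident], of U g] by simp

lemma smooth_on_bilinear:
  "bounded_bilinear bl \<Longrightarrow> open U \<Longrightarrow> smooth_on U f \<Longrightarrow> smooth_on U g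
    \<Longrightarrow> smooth_on U (\<lambda>x. bl (f x) (g x))"
  unfolding smooth_on_def using Ck_on_bilinear by blast

lemmas smooth_on_scaleR = smooth_on_bilinear[OF bounded_bilinear_scaleR]
lemmas smooth_on_inner = smooth_on_bilinear[OF bounded_bilinear_inner]
lemmas smooth_on_blinfun_apply = smooth_on_bilinear[OF bounded_bilinear_blinfun_apply]

lemma smooth_on_sum:
  "open U \<Longrightarrow> (\<And>i. i \<in> I \<Longrightarrow> smooth_on U (f i)) \<Longrightarrow> smooth_on U (\<lambda>x. \<Sum>i\<in>I. f i x)"
  by (induction I rule: infinite_finite_induct) (auto intro: smooth_on_add)

lemma smooth_on_divide:
  fixes f g :: "'a::euclidean_space \<Rightarrow> real"
  assumes "open U" "smooth_on U f" "smooth_on U g" "\<And>x. x \<in> U \<Longrightarrow> g x \<noteq> 0"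
  shows "smooth_on U (\<lambda>x. f x / g x)"
  unfolding divide_inverse
  using assms Ck_on_inverse[OF assms(1) _ assms(4)]
  by (intro smooth_on_bilinear[OF bounded_bilinear_mult]) (auto simp: smooth_on_def)

lemma smooth_on_Pair:
  assumes "open U" "smooth_on U f" "smooth_on U g"
  shows "smooth_on U (\<lambda>x. (f x, g x))"
  using smooth_on_add[OF assms(1)
      smooth_on_bounded_linear[OF bounded_linear_Pair[OF bounded_linear_ident bounded_linear_zero] assms(1,2)]
      smooth_on_bounded_linear[OF bounded_linear_Pair[OF bounded_linear_zero bounded_linear_ident] assms(1,3)]]
  by simp

lemma smooth_onD: "smooth_on U f \<Longrightarrow> Ck_on k U f"
  by (simp add: smooth_on_def)

lemma smooth_on_continuous_on: "smooth_on U f \<Longrightarrow> continuous_on U f"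
  using smooth_onD[of U f 0] by simp

lemma smooth_on_frechet_derivative:
  assumes "smooth_on U f"
  shows "smooth_on U (\<lambda>x. fd f x v)"
  unfolding smooth_on_def
proof
  show "Ck_on k U (\<lambda>x. fd f x v)" for k
    using smooth_onD[OF assms, of "Suc k"] by simp
qed

lemma smooth_on_has_derivative: "smooth_on U f \<Longrightarrow> x \<in> U \<Longrightarrow> (f has_derivative fd f x) (at x)"
  using smooth_onD[of U f "Suc 0"] by (simp add: frechet_derivative_works[symmetric])

lemma smooth_onI:
  assumes "open U" "\<And>x. x \<in> U \<Longrightarrow> (f has_derivative f' x) (at x)" "\<And>v. smooth_on U (\<lambda>x. f' x v)"
  shows "smooth_on U f"
proof -
  \<comment> \<open>The derivative certifies positive orders only; order 0 follows by descending
    from order 1.\<close>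
  have S: "Ck_on (Suc k) U f" for k
    using assms by (intro Ck_on_Suc_intro) (auto simp: smooth_on_def)
  show ?thesis
    unfolding smooth_on_def using Ck_on_SucD[OF S] by blast
qed

text \<open>Separates the base point from the direction: each \<open>fd f x b\<close> has a fixed
  direction, which is what \<open>Ck_on\<close> controls, and \<open>v\<close> enters through its
  coordinates alone.\<close>

lemma linear_frechet_derivative_apply:
  fixes f :: "'a::euclidean_space \<Rightarrow> 'b::real_normed_vector"
  assumes "(f has_derivative fd f x) (at x)"
  shows "fd f x v = (\<Sum>b\<in>Basis. (v \<bullet> b) *\<^sub>R fd f x b)"
proof -
  have "fd f x (\<Sum>b\<in>Basis. (v \<bullet> b) *\<^sub>R b) = (\<Sum>b\<in>Basis. (v \<bullet> b) *\<^sub>R fd f x b)"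
    using has_derivative_linear[OF assms] by (simp only: linear_sum linear_scale)
  then show ?thesis by (simp only: euclidean_representation)
qed

lemma smooth_on_frechet_derivative_apply:
  assumes "open U" "smooth_on U f" "smooth_on U X"
  shows "smooth_on U (\<lambda>x. fd f x (X x))"
proof (rule smooth_on_cong[OF assms(1)])
  show "(\<Sum>b\<in>Basis. (X x \<bullet> b) *\<^sub>R fd f x b) = fd f x (X x)" if "x \<in> U" for x
    using linear_frechet_derivative_apply[OF smooth_on_has_derivative[OF assms(2) that]] by metis
qed (intro smooth_on_sum smooth_on_scaleR smooth_on_inner smooth_on_frechet_derivative assms smooth_on_const)

section \<open>Operator-valued maps and smoothness of the operations on fields and forms\<close>

lemma Blinfun_eq_sum:
  fixes l :: "'c::euclidean_space \<Rightarrow> 'b::real_normed_vector"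
  assumes "linear l"
  shows "Blinfun l = (\<Sum>b\<in>Basis. blinfun_scaleR_left (l b) o\<^sub>L blinfun_inner_left b)"
proof (rule blinfun_eqI)
  fix v
  have "blinfun_apply (Blinfun l) v = l (\<Sum>b\<in>Basis. (v \<bullet> b) *\<^sub>R b)"
    by (simp only: euclidean_representation
        bounded_linear_Blinfun_apply[OF assms[unfolded linear_conv_bounded_linear]])
  also have "\<dots> = (\<Sum>b\<in>Basis. (v \<bullet> b) *\<^sub>R l b)"
    by (simp only: linear_sum[OF assms] linear_scale[OF assms])
  finally show "blinfun_apply (Blinfun l) v
      = blinfun_apply (\<Sum>b\<in>Basis. blinfun_scaleR_left (l b) o\<^sub>L blinfun_inner_left b) v"
    by (simp add: blinfun.sum_left blinfun_inner_left.rep_eq inner_commute)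
qed

text \<open>In coordinates an operator is a fixed linear expression in its values on the basis, so
  smoothness of these values suffices.\<close>

lemma smooth_on_Blinfun:
  fixes l :: "'a::euclidean_space \<Rightarrow> 'c::euclidean_space \<Rightarrow> 'b::real_normed_vector"
  assumes "open U" "\<And>x. x \<in> U \<Longrightarrow> linear (l x)" "\<And>v. smooth_on U (\<lambda>x. l x v)"
  shows "smooth_on U (\<lambda>x. Blinfun (l x))"
proof (rule smooth_on_cong[OF assms(1)])
  show "(\<Sum>b\<in>Basis. blinfun_scaleR_left (l x b) o\<^sub>L blinfun_inner_left b) = Blinfun (l x)"
    if "x \<in> U" for x
    using Blinfun_eq_sum[OF assms(2)[OF that]] by simp
qed (intro smooth_on_sum assms smooth_on_const smooth_on_bilinear[OF bounded_bilinear_blinfun_compose]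
      smooth_on_bounded_linear[OF bounded_linear_blinfun_scaleR_left])

text \<open>\<open>Blinfun\<close> can be undone only on bounded linear maps, and differentiability
  at \<open>p\<close> guarantees that it meets one.\<close>

lemma differential_apply:
  assumes "(f has_derivative fd f p) (at p)"
  shows "blinfun_apply (differential f p) = fd f p"
  unfolding differential_def
  using assms by (simp add: bounded_linear_Blinfun_apply has_derivative_bounded_linear)

lemma smooth_differential:
  assumes "smooth f"
  shows "smooth (differential f)"
  unfolding differential_def[abs_def]
  using assms
  by (intro smooth_on_Blinfun smooth_on_frechet_derivative)
     (auto intro: has_derivative_linear smooth_on_has_derivative)

lemma smooth_lie_bracket:
  assumes "smooth X" "smooth Y"
  shows "smooth (lie_bracket X Y)"
  unfolding lie_bracket_def[abs_def]
  using assms by (intro smooth_on_diff smooth_on_frechet_derivative_apply) auto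

lemma linear_lie_derivative:
  assumes "smooth X" "smooth \<beta>"
  shows "linear (\<lambda>v. blinfun_apply (fd \<beta> p (X p)) v + blinfun_apply (\<beta> p) (fd X p v))"
proof -
  have "bounded_linear (fd X p)"
    using smooth_on_has_derivative[OF assms(1) UNIV_I] by (rule has_derivative_bounded_linear)
  then have "bounded_linear (\<lambda>v. blinfun_apply (fd \<beta> p (X p)) v + blinfun_apply (\<beta> p) (fd X p v))"
    by (intro bounded_linear_add blinfun.bounded_linear_right
        bounded_linear_compose[OF blinfun.bounded_linear_right])
  then show ?thesis by (simp add: bounded_linear.linear)
qed

lemma lie_derivative_apply:
  assumes "smooth X" "smooth \<beta>"
  shows "blinfun_apply (lie_derivative X \<beta> p) v
    = blinfun_apply (fd \<beta> p (X p)) v + blinfun_apply (\<beta> p) (fd X p v)"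
  unfolding lie_derivative_def
  using linear_lie_derivative[OF assms, of p]
  by (simp add: bounded_linear_Blinfun_apply linear_conv_bounded_linear)

lemma smooth_lie_derivative:
  assumes "smooth X" "smooth \<beta>"
  shows "smooth (lie_derivative X \<beta>)"
  unfolding lie_derivative_def[abs_def]
  by (intro smooth_on_Blinfun linear_lie_derivative smooth_on_add smooth_on_blinfun_apply
      smooth_on_frechet_derivative_apply smooth_on_frechet_derivative assms smooth_on_const open_UNIV)

lemma smooth_courant_bracket:
  assumes "smooth a" "smooth b"
  shows "smooth (courant_bracket a b)"
proof -
  have s: "smooth (fst \<circ> a)" "smooth (snd \<circ> a)" "smooth (fst \<circ> b)" "smooth (snd \<circ> b)"
    using assms[THEN smooth_on_bounded_linear[OF bounded_linear_fst open_UNIV]]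
      assms[THEN smooth_on_bounded_linear[OF bounded_linear_snd open_UNIV]]
    by (simp_all add: o_def)
  show ?thesis
    unfolding courant_bracket_def Let_def
    by (intro smooth_on_Pair smooth_on_add smooth_on_diff smooth_on_scaleR smooth_on_const
        smooth_lie_bracket smooth_lie_derivative smooth_differential smooth_on_blinfun_apply
        open_UNIV s)
qed

subsection \<open>Integral manifolds and involutivity\<close>

lemma has_derivative_along_line:
  fixes f :: "'a::real_normed_vector \<Rightarrow> real"
  assumes "(f has_derivative f') (at (a + s *\<^sub>R u))"
  shows "((\<lambda>s. f (a + s *\<^sub>R u)) has_real_derivative f' u) (at s)"
proof -
  have "((\<lambda>s. a + s *\<^sub>R u) has_derivative (\<lambda>t. t *\<^sub>R u)) (at s)"
    by (auto intro!: derivative_eq_intros)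
  from has_derivative_compose[OF this assms]
  have "((\<lambda>s. f (a + s *\<^sub>R u)) has_derivative (\<lambda>t. f' (t *\<^sub>R u))) (at s)" .
  moreover have "(\<lambda>t. f' (t *\<^sub>R u)) = (*) (f' u)"
    using linear_scale[OF has_derivative_linear[OF assms], of _ u] by (auto simp: mult.commute)
  ultimately show ?thesis by (simp add: has_field_derivative_def)
qed

text \<open>The mean value theorem is applied twice, along \<open>u\<close> and then along
  \<open>v\<close>. The bound on \<open>e\<close> keeps the whole parallelogram inside the
  ball.\<close>

lemma second_difference:
  fixes f :: "'a::euclidean_space \<Rightarrow> real"
  assumes f: "smooth_on U f" and U: "ball p r \<subseteq> U"
    and e: "0 < e" "e * (norm u + norm v) < r"
  obtains x where "x \<in> ball p r"
    "f (p + e *\<^sub>R u + e *\<^sub>R v) - f (p + e *\<^sub>R u) - f (p + e *\<^sub>R v) + f p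
      = e\<^sup>2 * fd (\<lambda>y. fd f y u) x v"
proof -
  have near: "p + s *\<^sub>R u + t *\<^sub>R v \<in> ball p r" if "0 \<le> s" "s \<le> e" "0 \<le> t" "t \<le> e" for s t
  proof -
    have "dist p (p + s *\<^sub>R u + t *\<^sub>R v) = norm (s *\<^sub>R u + t *\<^sub>R v)"
      by (metis add.assoc add_diff_cancel_left' dist_commute dist_norm)
    also have "\<dots> \<le> s * norm u + t * norm v"
      using norm_triangle_ineq[of "s *\<^sub>R u" "t *\<^sub>R v"] that by simp
    also have "\<dots> \<le> e * norm u + e * norm v"
      using that by (intro add_mono mult_right_mono) auto
    finally show ?thesis
      using e(2) by (simp add: ring_distribs)
  qed
  \<comment> \<open>\<open>g e - g 0\<close> is the second difference, and the derivative of
    \<open>g\<close> is itself a difference in direction \<open>v\<close>, ready for the second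
    application.\<close>
  define g where "g s = f (p + e *\<^sub>R v + s *\<^sub>R u) - f (p + s *\<^sub>R u)" for s
  have "(g has_real_derivative fd f (p + e *\<^sub>R v + s *\<^sub>R u) u - fd f (p + s *\<^sub>R u) u) (at s)"
    if "0 \<le> s" "s \<le> e" for s
    unfolding g_def
    using near[OF that, of e] near[OF that, of 0] e U
    by (intro DERIV_diff has_derivative_along_line smooth_on_has_derivative[OF f])
       (auto simp: add_ac)
  from MVT2[OF e(1) this] obtain s where s: "0 < s" "s < e"
    and gs: "g e - g 0 = e * (fd f (p + e *\<^sub>R v + s *\<^sub>R u) u - fd f (p + s *\<^sub>R u) u)"
    by auto
  have "((\<lambda>t. fd f (p + s *\<^sub>R u + t *\<^sub>R v) u) has_real_derivative
      fd (\<lambda>y. fd f y u) (p + s *\<^sub>R u + t *\<^sub>R v) v) (at t)"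
    if "0 \<le> t" "t \<le> e" for t
    using near[of s t] s that U
    by (intro has_derivative_along_line smooth_on_has_derivative[OF smooth_on_frechet_derivative[OF f]])
       auto
  from MVT2[OF e(1) this] obtain t where t: "0 < t" "t < e"
    and ht: "fd f (p + s *\<^sub>R u + e *\<^sub>R v) u - fd f (p + s *\<^sub>R u + 0 *\<^sub>R v) u
      = e * fd (\<lambda>y. fd f y u) (p + s *\<^sub>R u + t *\<^sub>R v) v"
    by auto
  show ?thesis
  proof
    show "p + s *\<^sub>R u + t *\<^sub>R v \<in> ball p r"
      using near[of s t] s t by simp
    show "f (p + e *\<^sub>R u + e *\<^sub>R v) - f (p + e *\<^sub>R u) - f (p + e *\<^sub>R v) + f p
      = e\<^sup>2 * fd (\<lambda>y. fd f y u) (p + s *\<^sub>R u + t *\<^sub>R v) v"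
      using gs ht by (simp add: g_def power2_eq_square algebra_simps)
  qed
qed

text \<open>The second difference does not change when \<open>u\<close> and \<open>v\<close> are
  exchanged, so the two mixed derivatives share a value, at possibly different points of an
  arbitrarily small ball. Continuity carries the equality to \<open>p\<close>, with an error of half
  of \<epsilon> from each side.\<close>

lemma second_derivative_symmetric_real:
  fixes f :: "'a::euclidean_space \<Rightarrow> real"
  assumes f: "smooth_on U f" and "open U" "p \<in> U"
  shows "fd (\<lambda>y. fd f y u) p v = fd (\<lambda>y. fd f y v) p u"
proof (rule dense_eq0_I[of "fd (\<lambda>y. fd f y u) p v - fd (\<lambda>y. fd f y v) p u", simplified])
  fix \<epsilon> :: real assume "0 < \<epsilon>"
  have near: "\<forall>\<^sub>F x in nhds p. \<bar>fd (\<lambda>y. fd f y a) x b - fd (\<lambda>y. fd f y a) p b\<bar> < \<epsilon> / 2" for a b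
  proof -
    have "isCont (\<lambda>x. fd (\<lambda>y. fd f y a) x b) p"
      using smooth_on_continuous_on[OF smooth_on_frechet_derivative[OF smooth_on_frechet_derivative[OF f]]]
        assms by (simp add: continuous_on_eq_continuous_at)
    then have "((\<lambda>x. fd (\<lambda>y. fd f y a) x b) \<longlongrightarrow> fd (\<lambda>y. fd f y a) p b) (nhds p)"
      unfolding isCont_def by (rule tendsto_at_iff_tendsto_nhds[THEN iffD1])
    then show ?thesis
      using half_gt_zero[OF \<open>0 < \<epsilon>\<close>] unfolding tendsto_iff dist_real_def by blast
  qed
  have "\<forall>\<^sub>F x in nhds p. x \<in> U"
    using assms by (simp add: eventually_nhds_in_open)
  with near[of u v] near[of v u]
  have "\<forall>\<^sub>F x in nhds p. x \<in> U \<and> \<bar>fd (\<lambda>y. fd f y u) x v - fd (\<lambda>y. fd f y u) p v\<bar> < \<epsilon> / 2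
     \<and> \<bar>fd (\<lambda>y. fd f y v) x u - fd (\<lambda>y. fd f y v) p u\<bar> < \<epsilon> / 2"
    by eventually_elim auto
  then obtain r where r: "0 < r"
    and b: "\<And>x. x \<in> ball p r \<Longrightarrow> x \<in> U \<and> \<bar>fd (\<lambda>y. fd f y u) x v - fd (\<lambda>y. fd f y u) p v\<bar> < \<epsilon> / 2
     \<and> \<bar>fd (\<lambda>y. fd f y v) x u - fd (\<lambda>y. fd f y v) p u\<bar> < \<epsilon> / 2"
    unfolding eventually_nhds_metric by (auto simp: dist_commute)
  \<comment> \<open>The summand 1 keeps the denominator positive even when \<open>u\<close> and
    \<open>v\<close> both vanish.\<close>
  define e where "e = r / (2 * (norm u + norm v + 1))"
  have pos: "norm u + norm v + 1 > 0"
    by (simp add: add_nonneg_pos)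
  then have e: "0 < e" using r by (simp add: e_def)
  have "e * (norm u + norm v) < e * (2 * (norm u + norm v + 1))"
    using e pos by (intro mult_strict_left_mono) auto
  also have "\<dots> = r" using pos by (simp add: e_def)
  finally have er: "e * (norm u + norm v) < r" .
  have U: "ball p r \<subseteq> U" using b by blast
  obtain x where x: "x \<in> ball p r"
    and dx: "f (p + e *\<^sub>R u + e *\<^sub>R v) - f (p + e *\<^sub>R u) - f (p + e *\<^sub>R v) + f p
      = e\<^sup>2 * fd (\<lambda>y. fd f y u) x v"
    using second_difference[OF f U e er] .
  obtain x' where x': "x' \<in> ball p r"
    and dx': "f (p + e *\<^sub>R v + e *\<^sub>R u) - f (p + e *\<^sub>R v) - f (p + e *\<^sub>R u) + f p
      = e\<^sup>2 * fd (\<lambda>y. fd f y v) x' u"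
    using second_difference[OF f U e er[unfolded add.commute[of "norm u"]]] .
  have "e\<^sup>2 * fd (\<lambda>y. fd f y u) x v = e\<^sup>2 * fd (\<lambda>y. fd f y v) x' u"
    unfolding dx[symmetric] dx'[symmetric] by (simp add: add_ac)
  then have "fd (\<lambda>y. fd f y u) x v = fd (\<lambda>y. fd f y v) x' u"
    using e by simp
  then show "\<bar>fd (\<lambda>y. fd f y u) p v - fd (\<lambda>y. fd f y v) p u\<bar> \<le> \<epsilon>"
    using b[OF x] b[OF x'] by linarith
qed

lemma second_derivative_symmetric:
  fixes f :: "'a::euclidean_space \<Rightarrow> 'b::euclidean_space"
  assumes f: "smooth_on U f" and U: "open U" "p \<in> U"
  shows "fd (\<lambda>y. fd f y u) p v = fd (\<lambda>y. fd f y v) p u"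
proof (rule euclidean_eqI)
  fix b :: 'b assume "b \<in> Basis"
  define g where "g x = f x \<bullet> b" for x
  have g: "smooth_on U g"
    unfolding g_def using f U(1) by (rule smooth_on_bounded_linear[OF bounded_linear_inner_left, rotated])
  have d1: "fd g x w = fd f x w \<bullet> b" if "x \<in> U" for x w
    using frechet_derivative_at[OF has_derivative_inner_left[OF smooth_on_has_derivative[OF f that], of b]]
    unfolding g_def by metis
  have d2: "fd (\<lambda>y. fd g y w) p w' = fd (\<lambda>y. fd f y w) p w' \<bullet> b" for w w'
  proof -
    have "((\<lambda>y. fd f y w \<bullet> b) has_derivative (\<lambda>h. fd (\<lambda>y. fd f y w) p h \<bullet> b)) (at p)"
      by (intro has_derivative_inner_left smooth_on_has_derivative[OF smooth_on_frechet_derivative[OF f] U(2)])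
    then have "((\<lambda>y. fd g y w) has_derivative (\<lambda>h. fd (\<lambda>y. fd f y w) p h \<bullet> b)) (at p)"
      by (rule has_derivative_transform_within_open[OF _ U]) (simp add: d1)
    from frechet_derivative_at[OF this] show ?thesis by metis
  qed
  show "fd (\<lambda>y. fd f y u) p v \<bullet> b = fd (\<lambda>y. fd f y v) p u \<bullet> b"
    using second_derivative_symmetric_real[OF g U, of u v] by (simp add: d2)
qed

section \<open>Differentiating membership in a subspace, and involutivity\<close>

lemma mem_subspace_orthogonalI:
  fixes W :: "'a::euclidean_space set"
  assumes "subspace W" "\<And>y. (\<And>w. w \<in> W \<Longrightarrow> y \<bullet> w = 0) \<Longrightarrow> y \<bullet> x = 0"
  shows "x \<in> W"
proof -
  obtain y z where yz: "y \<in> span W" "\<And>w. w \<in> span W \<Longrightarrow> orthogonal z w" "x = y + z"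
    using orthogonal_subspace_decomp_exists by metis
  \<comment> \<open>The component \<open>z\<close> is orthogonal to \<open>W\<close>, hence to
    \<open>x\<close> by hypothesis and to \<open>y\<close> by construction, and so to
    itself.\<close>
  then have "z \<bullet> x = 0" "z \<bullet> y = 0"
    using assms(2)[of z] by (auto simp: orthogonal_def span_base)
  then have "z \<bullet> z = 0" using yz(3) by (simp add: inner_add_right)
  then show ?thesis using yz assms(1) by (simp add: span_eq_iff[THEN iffD2])
qed

text \<open>Membership in \<open>W\<close> becomes a family of scalar equations
  \<open>y \<bullet> \<gamma> t = 0\<close>, each of which can be differentiated.\<close>

lemma derivative_in_subspace:
  fixes \<gamma> :: "real \<Rightarrow> 'a::euclidean_space"
  assumes W: "subspace W" and \<gamma>: "(\<gamma> has_derivative \<gamma>') (at 0)"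
    and ev: "\<forall>\<^sub>F t in nhds 0. \<gamma> t \<in> W"
  shows "\<gamma>' s \<in> W"
proof (rule mem_subspace_orthogonalI[OF W])
  fix y assume y: "\<And>w. w \<in> W \<Longrightarrow> y \<bullet> w = 0"
  have "\<forall>\<^sub>F t in nhds 0. y \<bullet> \<gamma> t = 0"
    using ev by eventually_elim (rule y)
  moreover have "((\<lambda>t. y \<bullet> \<gamma> t) has_derivative (\<lambda>s. y \<bullet> \<gamma>' s)) (at 0)"
    by (intro has_derivative_inner_right \<gamma>)
  ultimately have "((\<lambda>t. 0) has_derivative (\<lambda>s. y \<bullet> \<gamma>' s)) (at (0::real))"
    using has_derivative_transform_eventually[of _ _ 0 UNIV "\<lambda>_. 0"]
    by (auto simp: eventually_nhds_conv_at)
  then have "(\<lambda>s. y \<bullet> \<gamma>' s) = (\<lambda>s. 0)"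
    using has_derivative_unique[OF _ has_derivative_const] by blast
  then show "y \<bullet> \<gamma>' s = 0" by meson
qed

text \<open>Differentiating \<open>d\<phi>(Z) \<in> W\<close> along a curve in the integral manifold through \<open>p\<close>.\<close>

lemma flattened_field_derivative:
  fixes \<phi> \<psi> Z :: "'a::euclidean_space \<Rightarrow> 'a"
  assumes U: "open U" "p \<in> U" and V: "open V"
    and \<phi>: "smooth_on U \<phi>" and \<psi>: "smooth_on V \<psi>" and h: "homeomorphism U V \<phi> \<psi>"
    and W: "subspace W" and N: "\<phi> ` (N \<inter> U) = V \<inter> W" "p \<in> N"
    and D: "\<forall>r\<in>N \<inter> U. D r = {v. fd \<phi> r v \<in> W}"
    and u: "u \<in> D p"
    and Z: "(Z has_derivative fd Z p) (at p)" "\<forall>\<^sub>F q in nhds p. Z q \<in> D q"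
  shows "fd (\<lambda>q. fd \<phi> q (Z p)) p u + fd \<phi> p (fd Z p u) \<in> W"
proof -
  have \<psi>\<phi>: "\<psi> (\<phi> q) = q" if "q \<in> U" for q
    using h that by (rule homeomorphism_apply1)
  define w where "w = fd \<phi> p u"
  have pN: "p \<in> N \<inter> U" using N(2) U(2) by simp
  have w: "w \<in> W" using u bspec[OF D pN] by (simp add: w_def)
  have \<phi>p: "\<phi> p \<in> V" "\<phi> p \<in> W"
    using imageI[OF pN, of \<phi>] unfolding N(1) by simp_all
  \<comment> \<open>Differentiating \<open>\<psi> (\<phi> q) = q\<close> shows that the derivative
    of \<psi> takes \<open>w\<close> back to \<open>u\<close>.\<close>
  have "((\<lambda>q. \<psi> (\<phi> q)) has_derivative (\<lambda>v. fd \<psi> (\<phi> p) (fd \<phi> p v))) (at p)"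
    by (rule has_derivative_compose[OF smooth_on_has_derivative[OF \<phi> U(2)]
          smooth_on_has_derivative[OF \<psi> \<phi>p(1)]])
  moreover have "((\<lambda>q. \<psi> (\<phi> q)) has_derivative (\<lambda>v. v)) (at p)"
    by (rule has_derivative_transform_within_open[OF has_derivative_ident U]) (simp add: \<psi>\<phi>)
  ultimately have \<psi>w: "fd \<psi> (\<phi> p) w = u"
    unfolding w_def by (rule has_derivative_unique[THEN fun_cong])
  \<comment> \<open>The straight line in \<open>W\<close> with velocity \<open>w\<close>, pulled
    back by the chart: a curve through \<open>p\<close> with velocity \<open>u\<close>.\<close>
  define c where "c t = \<psi> (\<phi> p + t *\<^sub>R w)" for t
  have c0: "c 0 = p" using \<psi>\<phi>[OF U(2)] by (simp add: c_def)
  have "((\<lambda>t. \<phi> p + t *\<^sub>R w) has_derivative (\<lambda>t. t *\<^sub>R w)) (at 0)"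
    by (auto intro!: derivative_eq_intros)
  moreover have "(\<psi> has_derivative fd \<psi> (\<phi> p)) (at (\<phi> p + 0 *\<^sub>R w))"
    using smooth_on_has_derivative[OF \<psi> \<phi>p(1)] by simp
  ultimately have "(c has_derivative (\<lambda>t. fd \<psi> (\<phi> p) (t *\<^sub>R w))) (at 0)"
    unfolding c_def by (rule has_derivative_compose)
  then have c': "(c has_derivative (\<lambda>t. t *\<^sub>R u)) (at 0)"
    using linear_scale[OF has_derivative_linear[OF smooth_on_has_derivative[OF \<psi> \<phi>p(1)]], of _ w]
    by (simp add: \<psi>w)
  have "((\<lambda>t. \<phi> p + t *\<^sub>R w) \<longlongrightarrow> \<phi> p + 0 *\<^sub>R w) (nhds 0)"
    by (intro tendsto_intros filterlim_ident)
  then have "\<forall>\<^sub>F t in nhds 0. \<phi> p + t *\<^sub>R w \<in> V"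
    using topological_tendstoD[OF _ V, of _ "\<phi> p"] \<phi>p(1) by simp
  \<comment> \<open>For small \<open>t\<close> the line stays in \<open>V \<inter> W\<close>, which
    is the image of the integral manifold.\<close>
  then have cN: "\<forall>\<^sub>F t in nhds 0. c t \<in> N \<inter> U"
  proof eventually_elim
    case (elim t)
    then have "\<phi> p + t *\<^sub>R w \<in> \<phi> ` (N \<inter> U)"
      unfolding N(1) using W w \<phi>p by (simp add: subspace_add subspace_scale)
    then show ?case by (auto simp: c_def \<psi>\<phi>)
  qed
  \<comment> \<open>\<open>Z\<close> lies in \<open>D\<close> only near \<open>p\<close>, hence
    along \<open>c\<close> only for small \<open>t\<close>.\<close>
  have "(c \<longlongrightarrow> p) (nhds 0)"
    using has_derivative_continuous[OF c']
    unfolding isCont_def c0[symmetric] by (rule tendsto_at_iff_tendsto_nhds[THEN iffD1])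
  then have "\<forall>\<^sub>F t in nhds 0. Z (c t) \<in> D (c t)"
    by (rule eventually_compose_filterlim[OF Z(2)])
  with cN have G: "\<forall>\<^sub>F t in nhds 0. fd \<phi> (c t) (Z (c t)) \<in> W"
    by eventually_elim (use D in auto)
  \<comment> \<open>In \<open>d\<phi>(Z)\<close> both the base point and the direction move.
    Expansion in the basis makes it a sum of products of differentiable factors, and the same
    expansion with constant \<open>Z p\<close> recombines the result.\<close>
  define \<Phi> where "\<Phi> q b = fd \<phi> q b" for q b
  have \<Phi>': "((\<lambda>q. \<Phi> q b) has_derivative fd (\<lambda>q. \<Phi> q b) p) (at p)" for b
    unfolding \<Phi>_def by (intro smooth_on_has_derivative[OF smooth_on_frechet_derivative[OF \<phi>] U(2)])
  have lin: "\<Phi> q v = (\<Sum>b\<in>Basis. (v \<bullet> b) *\<^sub>R \<Phi> q b)" if "q \<in> U" for q v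
    unfolding \<Phi>_def by (rule linear_frechet_derivative_apply[OF smooth_on_has_derivative[OF \<phi> that]])
  have "((\<lambda>q. \<Sum>b\<in>Basis. (z \<bullet> b) *\<^sub>R \<Phi> q b)
      has_derivative (\<lambda>v. \<Sum>b\<in>Basis. (z \<bullet> b) *\<^sub>R fd (\<lambda>q. \<Phi> q b) p v)) (at p)" for z
    by (intro has_derivative_sum has_derivative_scaleR_right \<Phi>')
  then have "((\<lambda>q. \<Phi> q z) has_derivative (\<lambda>v. \<Sum>b\<in>Basis. (z \<bullet> b) *\<^sub>R fd (\<lambda>q. \<Phi> q b) p v)) (at p)" for z
    by (rule has_derivative_transform_within_open[OF _ U]) (rule lin[symmetric])
  from frechet_derivative_at[OF this]
  have dz: "fd (\<lambda>q. \<Phi> q z) p v = (\<Sum>b\<in>Basis. (z \<bullet> b) *\<^sub>R fd (\<lambda>q. \<Phi> q b) p v)" for z v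
    by (rule fun_cong[OF sym])
  have "((\<lambda>q. \<Sum>b\<in>Basis. (Z q \<bullet> b) *\<^sub>R \<Phi> q b) has_derivative
      (\<lambda>v. \<Sum>b\<in>Basis. (Z p \<bullet> b) *\<^sub>R fd (\<lambda>q. \<Phi> q b) p v + (fd Z p v \<bullet> b) *\<^sub>R \<Phi> p b)) (at p)"
    by (intro has_derivative_sum has_derivative_scaleR has_derivative_inner_left \<Phi>' Z(1))
  then have "((\<lambda>q. \<Phi> q (Z q)) has_derivative
      (\<lambda>v. \<Sum>b\<in>Basis. (Z p \<bullet> b) *\<^sub>R fd (\<lambda>q. \<Phi> q b) p v + (fd Z p v \<bullet> b) *\<^sub>R \<Phi> p b)) (at p)"
    by (rule has_derivative_transform_within_open[OF _ U]) (rule lin[symmetric])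
  moreover have "(\<lambda>v. \<Sum>b\<in>Basis. (Z p \<bullet> b) *\<^sub>R fd (\<lambda>q. \<Phi> q b) p v + (fd Z p v \<bullet> b) *\<^sub>R \<Phi> p b)
      = (\<lambda>v. fd (\<lambda>q. \<Phi> q (Z p)) p v + \<Phi> p (fd Z p v))"
    by (simp only: sum.distrib dz[symmetric] lin[OF U(2), symmetric])
  ultimately have "((\<lambda>q. \<Phi> q (Z q)) has_derivative
      (\<lambda>v. fd (\<lambda>q. \<Phi> q (Z p)) p v + \<Phi> p (fd Z p v))) (at (c 0))"
    by (simp add: c0)
  from derivative_in_subspace[OF W has_derivative_compose[OF c' this] G[folded \<Phi>_def], of 1]
  show ?thesis by (simp add: \<Phi>_def)
qed

text \<open>Differentiating \<open>Y\<close> along \<open>X\<close> and \<open>X\<close> along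
  \<open>Y\<close> gives two elements of \<open>W\<close>. Their difference loses the second
  derivatives of \<phi> and leaves the image of the bracket under \<open>fd \<phi> p\<close>, which
  is the tangency condition at \<open>p\<close>.\<close>

lemma integrable_distribution_involutive:
  fixes D :: "'a::euclidean_space \<Rightarrow> 'a set"
  assumes "integrable_distribution D"
    and X: "(X has_derivative fd X p) (at p)" "\<forall>\<^sub>F q in nhds p. X q \<in> D q"
    and Y: "(Y has_derivative fd Y p) (at p)" "\<forall>\<^sub>F q in nhds p. Y q \<in> D q"
  shows "lie_bracket X Y p \<in> D p"
proof -
  obtain N where N: "p \<in> N" "integral_manifold D N"
    using assms(1) unfolding integrable_distribution_def by blast
  then obtain U V and \<phi> \<psi> :: "'a \<Rightarrow> 'a" and W
    where U: "open U" "p \<in> U" and V: "open V"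
    and \<phi>: "smooth_on U \<phi>" and \<psi>: "smooth_on V \<psi>" and h: "homeomorphism U V \<phi> \<psi>"
    and W: "subspace W" and NW: "\<phi> ` (N \<inter> U) = V \<inter> W"
    and D: "\<forall>r\<in>N \<inter> U. D r = {v. fd \<phi> r v \<in> W}"
    unfolding integral_manifold_def by metis
  note flat = flattened_field_derivative[OF U V \<phi> \<psi> h W NW N(1) D]
  have "fd (\<lambda>q. fd \<phi> q (Y p)) p (X p) + fd \<phi> p (fd Y p (X p)) \<in> W"
    using flat[OF _ Y] eventually_nhds_x_imp_x[OF X(2)] by blast
  moreover have "fd (\<lambda>q. fd \<phi> q (X p)) p (Y p) + fd \<phi> p (fd X p (Y p)) \<in> W"
    using flat[OF _ X] eventually_nhds_x_imp_x[OF Y(2)] by blast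
  ultimately have "fd \<phi> p (fd Y p (X p)) - fd \<phi> p (fd X p (Y p)) \<in> W"
    using subspace_diff[OF W] second_derivative_symmetric[OF \<phi> U, of "X p" "Y p"] by fastforce
  then have "fd \<phi> p (lie_bracket X Y p) \<in> W"
    using linear_diff[OF has_derivative_linear[OF smooth_on_has_derivative[OF \<phi> U(2)]]]
    by (simp add: lie_bracket_def)
  then show ?thesis using D N(1) U(2) by blast
qed

subsection \<open>Orthogonal frames\<close>

text \<open>Left unnormalised, so that only divisions occur and no square roots have to be shown
  smooth.\<close>

function gram_schmidt :: "(nat \<Rightarrow> 'a::real_inner) \<Rightarrow> nat \<Rightarrow> 'a" where
  "gram_schmidt f i = f i - (\<Sum>j<i. ((f i \<bullet> gram_schmidt f j)
     / (gram_schmidt f j \<bullet> gram_schmidt f j)) *\<^sub>R gram_schmidt f j)"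
  by auto
termination by lexicographic_order

declare gram_schmidt.simps [simp del]

text \<open>Independence is not assumed: if \<open>gram_schmidt f j\<close> is zero, its quotient is
  0 by convention and both sides vanish.\<close>

lemma gram_schmidt_orthogonal_less: "j < i \<Longrightarrow> gram_schmidt f i \<bullet> gram_schmidt f j = 0"
proof (induction i arbitrary: j rule: less_induct)
  case (less i)
  let ?g = "gram_schmidt f"
  have "(\<Sum>l<i. ((f i \<bullet> ?g l) / (?g l \<bullet> ?g l)) *\<^sub>R ?g l) \<bullet> ?g j
      = (\<Sum>l<i. if l = j then f i \<bullet> ?g j else 0)"
    unfolding inner_sum_left
  proof (rule sum.cong)
    fix l assume "l \<in> {..<i}"
    moreover have "?g l \<bullet> ?g j = 0" if "l < i" "l \<noteq> j"
      using less.IH[of l j] less.IH[of j l] that less.prems by (auto simp: inner_commute neq_iff)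
    ultimately show "((f i \<bullet> ?g l) / (?g l \<bullet> ?g l)) *\<^sub>R ?g l \<bullet> ?g j
        = (if l = j then f i \<bullet> ?g j else 0)"
      by auto
  qed simp
  then show ?case
    using less.prems by (subst gram_schmidt.simps) (simp add: inner_diff_left)
qed

lemma gram_schmidt_orthogonal: "i \<noteq> j \<Longrightarrow> gram_schmidt f i \<bullet> gram_schmidt f j = 0"
  using gram_schmidt_orthogonal_less[of i j f] gram_schmidt_orthogonal_less[of j i f]
  by (auto simp: inner_commute neq_iff)

lemma span_gram_schmidt: "span (gram_schmidt f ` {..<n}) = span (f ` {..<n})"
proof (induction n)
  case (Suc n)
  let ?g = "gram_schmidt f"
  let ?s = "\<Sum>j<n. ((f n \<bullet> ?g j) / (?g j \<bullet> ?g j)) *\<^sub>R ?g j"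
  have g: "?g n = f n - ?s" by (rule gram_schmidt.simps)
  have s: "?s \<in> span (insert x (?g ` {..<n}))" for x
    by (intro span_sum span_scale span_base) auto
  have "?g n \<in> span (insert (f n) (?g ` {..<n}))"
    unfolding g by (rule span_diff[OF span_base s]) simp
  moreover have "?g n + ?s \<in> span (insert (?g n) (?g ` {..<n}))"
    by (rule span_add[OF span_base s]) simp
  then have "f n \<in> span (insert (?g n) (?g ` {..<n}))"
    by (simp only: g diff_add_cancel)
  ultimately have "span (insert (?g n) (?g ` {..<n})) = span (insert (f n) (?g ` {..<n}))"
    unfolding span_eq by (auto intro: span_base)
  also have "\<dots> = span (insert (f n) (f ` {..<n}))"
    using Suc by (simp add: span_insert)
  finally show ?case by (simp add: lessThan_Suc)
qed simp

text \<open>A zero would express \<open>f i\<close> through earlier members of the family, against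
  independence.\<close>

lemma gram_schmidt_nonzero:
  assumes "inj_on f {..<n}" "independent (f ` {..<n})" "i < n"
  shows "gram_schmidt f i \<noteq> 0"
proof
  assume "gram_schmidt f i = 0"
  then have "f i = (\<Sum>j<i. ((f i \<bullet> gram_schmidt f j)
     / (gram_schmidt f j \<bullet> gram_schmidt f j)) *\<^sub>R gram_schmidt f j)"
    by (subst (asm) gram_schmidt.simps) simp
  also have "\<dots> \<in> span (gram_schmidt f ` {..<i})"
    by (intro span_sum span_scale span_base) auto
  also have "\<dots> = span (f ` {..<i})" by (rule span_gram_schmidt)
  also have "\<dots> \<subseteq> span (f ` {..<n} - {f i})"
    using assms(1,3) by (intro span_mono) (auto simp: inj_on_def)
  finally show False
    using assms(2,3) by (auto simp: dependent_def)
qed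

text \<open>Each vector divides by the squared lengths of its predecessors, so the neighbourhood
  shrinks once per index.\<close>

lemma gram_schmidt_smooth:
  fixes F :: "'a::euclidean_space \<Rightarrow> nat \<Rightarrow> 'b::euclidean_space"
  assumes "open U" "p \<in> U" "\<And>i. i < n \<Longrightarrow> smooth_on U (\<lambda>q. F q i)"
    and "\<And>i. i < n \<Longrightarrow> gram_schmidt (F p) i \<noteq> 0"
  obtains V where "open V" "p \<in> V" "V \<subseteq> U"
    "\<And>i. i < n \<Longrightarrow> smooth_on V (\<lambda>q. gram_schmidt (F q) i)"
    "\<And>i q. i < n \<Longrightarrow> q \<in> V \<Longrightarrow> gram_schmidt (F q) i \<noteq> 0"
  using assms(3,4)
proof (induction n arbitrary: thesis)
  case 0
  then show ?case using assms(1,2) by blast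
next
  case (Suc n)
  obtain V where V: "open V" "p \<in> V" "V \<subseteq> U"
    and g: "\<And>i. i < n \<Longrightarrow> smooth_on V (\<lambda>q. gram_schmidt (F q) i)"
      "\<And>i q. i < n \<Longrightarrow> q \<in> V \<Longrightarrow> gram_schmidt (F q) i \<noteq> 0"
    using Suc.IH Suc.prems(2,3) by (metis less_SucI)
  have "smooth_on V (\<lambda>q. F q n)"
    using Suc.prems(2)[of n] smooth_on_subset V(3) by blast
  then have gn: "smooth_on V (\<lambda>q. gram_schmidt (F q) n)"
    using g by (subst gram_schmidt.simps)
      (intro smooth_on_diff smooth_on_sum smooth_on_scaleR smooth_on_divide smooth_on_inner V(1), auto)
  \<comment> \<open>Nonvanishing at \<open>p\<close> persists near \<open>p\<close> by continuity,
    which makes this vector admissible as a divisor for the next.\<close>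
  define V' where "V' = V \<inter> (\<lambda>q. gram_schmidt (F q) n) -` (- {0})"
  have "open V'"
    unfolding V'_def
    using smooth_on_continuous_on[OF gn] V(1) by (intro continuous_open_preimage) auto
  moreover have "p \<in> V'" using V(2) Suc.prems(3) by (simp add: V'_def)
  moreover have "V' \<subseteq> U" using V(3) by (auto simp: V'_def)
  moreover have "smooth_on V' (\<lambda>q. gram_schmidt (F q) i)" if "i < Suc n" for i
  proof (rule smooth_on_subset)
    show "smooth_on V (\<lambda>q. gram_schmidt (F q) i)"
      using that gn g(1) by (cases "i = n") auto
  qed (auto simp: V'_def)
  moreover have "gram_schmidt (F q) i \<noteq> 0" if "i < Suc n" "q \<in> V'" for i q
    using that g(2)[of i q] by (cases "i = n") (auto simp: V'_def)
  ultimately show ?case by (rule Suc.prems(1))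
qed

section \<open>Independent families and orthogonal bases\<close>

lemma independent_family:
  fixes t :: "'i \<Rightarrow> 'b::real_vector"
  assumes "finite I" and indep: "\<And>c i. (\<Sum>i\<in>I. c i *\<^sub>R t i) = 0 \<Longrightarrow> i \<in> I \<Longrightarrow> c i = 0"
  shows "inj_on t I" "independent (t ` I)"
proof -
  show inj: "inj_on t I"
  proof (rule inj_onI, rule ccontr)
    fix a b assume ab: "a \<in> I" "b \<in> I" "t a = t b" "a \<noteq> b"
    \<comment> \<open>A repeated member gives a relation with coefficients 1 and -1.\<close>
    let ?c = "\<lambda>i. (if i = a then 1 else 0) - (if i = b then 1 else (0::real))"
    have "(\<Sum>i\<in>I. ?c i *\<^sub>R t i)
        = (\<Sum>i\<in>I. if i = a then t i else 0) - (\<Sum>i\<in>I. if i = b then t i else 0)"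
      unfolding sum_subtractf[symmetric] by (intro sum.cong) auto
    also have "\<dots> = 0" using ab assms(1) by simp
    finally show False using indep[of ?c a] ab by simp
  qed
  show "independent (t ` I)"
  proof (rule independent_if_scalars_zero)
    fix f x assume "(\<Sum>x\<in>t ` I. f x *\<^sub>R x) = 0" "x \<in> t ` I"
    then show "f x = 0"
      using indep[of "f \<circ> t"] inj by (auto simp: sum.reindex)
  qed (use assms in auto)
qed

lemma orthogonal_family_sum:
  assumes "finite I" "j \<in> I" "\<And>i. i \<in> I \<Longrightarrow> i \<noteq> j \<Longrightarrow> g i \<bullet> g j = 0"
  shows "(\<Sum>i\<in>I. c i *\<^sub>R g i) \<bullet> g j = c j * (g j \<bullet> g j)"
proof -
  have "(\<Sum>i\<in>I. c i *\<^sub>R g i) \<bullet> g j = (\<Sum>i\<in>I. if i = j then c j * (g j \<bullet> g j) else 0)"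
    unfolding inner_sum_left using assms(3) by (intro sum.cong) auto
  then show ?thesis using assms by simp
qed

definition orthogonal_frame :: "(nat \<Rightarrow> 'a::euclidean_space) \<Rightarrow> bool" where
  "orthogonal_frame g \<longleftrightarrow> (\<forall>i<DIM('a). g i \<noteq> 0) \<and>
     (\<forall>i<DIM('a). \<forall>j<DIM('a). i \<noteq> j \<longrightarrow> g i \<bullet> g j = 0)"

text \<open>Nonzero orthogonal vectors are independent, so \<open>DIM('a)\<close> of them span. The
  remainder \<open>y\<close> is orthogonal to all of them, hence to itself.\<close>

lemma orthogonal_frame_expansion:
  fixes g :: "nat \<Rightarrow> 'a::euclidean_space"
  assumes g: "orthogonal_frame g"
  shows "x = (\<Sum>j<DIM('a). ((x \<bullet> g j) / (g j \<bullet> g j)) *\<^sub>R g j)"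
proof -
  let ?I = "{..<DIM('a)}"
  have sum: "(\<Sum>i\<in>?I. c i *\<^sub>R g i) \<bullet> g j = c j * (g j \<bullet> g j)" if "j \<in> ?I" for c j
    using g that by (intro orthogonal_family_sum) (auto simp: orthogonal_frame_def)
  have nz: "g j \<bullet> g j \<noteq> 0" if "j \<in> ?I" for j
    using g that by (auto simp: orthogonal_frame_def)
  have "c j = 0" if "(\<Sum>i\<in>?I. c i *\<^sub>R g i) = 0" "j \<in> ?I" for c j
    using sum[OF that(2), of c] that nz by simp
  then have "inj_on g ?I" "independent (g ` ?I)"
    using independent_family[of ?I g] by blast+
  then have span: "UNIV \<subseteq> span (g ` ?I)"
    by (intro card_ge_dim_independent) (auto simp: card_image)
  define y where "y = x - (\<Sum>j\<in>?I. ((x \<bullet> g j) / (g j \<bullet> g j)) *\<^sub>R g j)"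
  have "y \<bullet> g j = 0" if "j \<in> ?I" for j
    using sum[OF that] nz[OF that] by (simp add: y_def inner_diff_left)
  then have "orthogonal y z" for z
    using span by (intro orthogonal_to_span[of z "g ` ?I"]) (auto simp: orthogonal_def)
  then have "y = 0" by (metis orthogonal_self)
  then show ?thesis by (simp add: y_def)
qed

text \<open>The given vectors keep their indices below \<open>k\<close>, so that Gram-Schmidt, whose
  initial spans depend on initial segments only, still yields \<open>D\<close> from the first
  \<open>k\<close> members.\<close>

lemma independent_extend_enumeration:
  fixes f :: "nat \<Rightarrow> 'a::euclidean_space"
  assumes "inj_on f {..<k}" "independent (f ` {..<k})"
  obtains h where "\<And>i. i < k \<Longrightarrow> h i = f i" "inj_on h {..<DIM('a)}" "independent (h ` {..<DIM('a)})"
    "k \<le> DIM('a)"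
proof -
  let ?S = "f ` {..<k}"
  define B where "B = extend_basis ?S"
  have B: "?S \<subseteq> B" "independent B" "span B = UNIV"
    using assms(2) extend_basis_superset independent_extend_basis span_extend_basis
    by (auto simp: B_def)
  have finB: "finite B" and cardB: "card B = DIM('a)"
    using B(2,3) independent_bound_general dim_span by (metis dim_UNIV dim_eq_card_independent)+
  have cardS: "card ?S = k" using assms(1) by (simp add: card_image)
  then have k: "k \<le> DIM('a)" using card_mono[OF finB B(1)] cardB by simp
  have "card (B - ?S) = DIM('a) - k"
    using B(1) cardB cardS by (simp add: card_Diff_subset)
  then obtain e where e: "bij_betw e {0..<DIM('a) - k} (B - ?S)"
    using ex_bij_betw_nat_finite[of "B - ?S"] finB by auto
  define h where "h i = (if i < k then f i else e (i - k))" for i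
  have "bij_betw (\<lambda>i. e (i - k)) {k..<DIM('a)} (B - ?S)"
  proof -
    have "bij_betw (\<lambda>i. i - k) {k..<DIM('a)} {0..<DIM('a) - k}"
      using k by (intro bij_betw_byWitness[where f' = "\<lambda>i. i + k"]) auto
    from bij_betw_trans[OF this e] show ?thesis by (simp add: o_def)
  qed
  then have b2: "bij_betw h {k..<DIM('a)} (B - ?S)"
    by (rule bij_betw_cong[THEN iffD1, rotated]) (auto simp: h_def)
  have b1: "bij_betw h {..<k} ?S"
    using assms(1) by (auto simp: bij_betw_def h_def inj_on_def)
  have "bij_betw h ({..<k} \<union> {k..<DIM('a)}) (?S \<union> (B - ?S))"
    by (rule bij_betw_combine[OF b1 b2]) auto
  moreover have "{..<k} \<union> {k..<DIM('a)} = {..<DIM('a)}" "?S \<union> (B - ?S) = B"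
    using k B(1) by auto
  ultimately have "bij_betw h {..<DIM('a)} B" by simp
  then show ?thesis
    using B(2) k by (intro that[of h]) (auto simp: bij_betw_def h_def)
qed

section \<open>Smooth local frames of subbundles\<close>

definition frame_on ::
  "nat \<Rightarrow> ('a::euclidean_space \<Rightarrow> 'b::real_normed_vector set) \<Rightarrow> 'a set \<Rightarrow> (nat \<Rightarrow> 'a \<Rightarrow> 'b) \<Rightarrow> bool" where
  "frame_on k B U s \<longleftrightarrow> open U \<and> (\<forall>i<k. smooth_on U (s i)) \<and>
     (\<forall>q\<in>U. inj_on (\<lambda>i. s i q) {..<k} \<and> independent ((\<lambda>i. s i q) ` {..<k}) \<and>
             span ((\<lambda>i. s i q) ` {..<k}) = B q)"

lemma smooth_subbundle_iff:
  "smooth_subbundle B \<longleftrightarrow> (\<exists>k. \<forall>p. \<exists>U s. p \<in> U \<and> frame_on k B U s)"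
  unfolding smooth_subbundle_def frame_on_def by (simp add: conj_left_commute)

text \<open>A frame of the whole tangent space adapted to \<open>D\<close>. The point comes before
  the index to match \<open>gram_schmidt (F q)\<close>.\<close>

definition orthogonal_frame_on ::
  "nat \<Rightarrow> ('a::euclidean_space \<Rightarrow> 'a set) \<Rightarrow> 'a set \<Rightarrow> ('a \<Rightarrow> nat \<Rightarrow> 'a) \<Rightarrow> bool" where
  "orthogonal_frame_on k D U g \<longleftrightarrow> open U \<and> (\<forall>i<DIM('a). smooth_on U (\<lambda>q. g q i)) \<and>
     (\<forall>q\<in>U. orthogonal_frame (g q) \<and> span (g q ` {..<k}) = D q)"

lemma frame_on_imp_orthogonal_frame_on:
  fixes D :: "'a::euclidean_space \<Rightarrow> 'a set"
  assumes s: "frame_on k D U s" and p: "p \<in> U"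
  obtains V g where "p \<in> V" "orthogonal_frame_on k D V g" "k \<le> DIM('a)"
proof -
  have U: "open U" using s by (simp add: frame_on_def)
  have sq: "inj_on (\<lambda>i. s i q) {..<k}" "independent ((\<lambda>i. s i q) ` {..<k})"
    "span ((\<lambda>i. s i q) ` {..<k}) = D q" if "q \<in> U" for q
    using s that by (auto simp: frame_on_def)
  obtain h where h: "\<And>i. i < k \<Longrightarrow> h i = s i p" "inj_on h {..<DIM('a)}" "independent (h ` {..<DIM('a)})"
    and k: "k \<le> DIM('a)"
    using independent_extend_enumeration[OF sq(1,2)[OF p]] by blast
  \<comment> \<open>The frame of \<open>D\<close> is completed by constant vectors. At
    \<open>p\<close> this is a basis, which makes the Gram-Schmidt vectors nonzero there and
    therefore nearby.\<close>
  define F where "F q i = (if i < k then s i q else h i)" for q i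
  have Fp: "F p = h" using h(1) by (auto simp: F_def)
  have nz: "gram_schmidt (F p) i \<noteq> 0" if "i < DIM('a)" for i
    unfolding Fp using gram_schmidt_nonzero[OF h(2,3) that] .
  have smF: "smooth_on U (\<lambda>q. F q i)" for i
    using s by (cases "i < k") (simp_all add: F_def frame_on_def)
  obtain V where V: "open V" "p \<in> V" "V \<subseteq> U"
    "\<And>i. i < DIM('a) \<Longrightarrow> smooth_on V (\<lambda>q. gram_schmidt (F q) i)"
    "\<And>i q. i < DIM('a) \<Longrightarrow> q \<in> V \<Longrightarrow> gram_schmidt (F q) i \<noteq> 0"
    using gram_schmidt_smooth[OF U p smF nz] by blast
  have "orthogonal_frame (gram_schmidt (F q)) \<and> span (gram_schmidt (F q) ` {..<k}) = D q"
    if "q \<in> V" for q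
  proof
    show "orthogonal_frame (gram_schmidt (F q))"
      unfolding orthogonal_frame_def using V(5)[OF _ that] gram_schmidt_orthogonal by blast
    have "F q ` {..<k} = (\<lambda>i. s i q) ` {..<k}" by (auto simp: F_def)
    then show "span (gram_schmidt (F q) ` {..<k}) = D q"
      using sq(3)[of q] V(3) that by (auto simp: span_gram_schmidt)
  qed
  with V(1,4) have "orthogonal_frame_on k D V (\<lambda>q. gram_schmidt (F q))"
    unfolding orthogonal_frame_on_def by blast
  with V(2) k show ?thesis by (intro that)
qed

lemma distribution_subspace:
  assumes "distribution D"
  shows "subspace (D p)"
proof -
  obtain k U s where "p \<in> U" "frame_on k D U s"
    using assms unfolding smooth_subbundle_iff by blast
  then have "span ((\<lambda>i. s i p) ` {..<k}) = D p" by (simp add: frame_on_def)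
  then show ?thesis by (metis subspace_span)
qed

text \<open>The coefficients of \<open>z\<close> in the frame at \<open>p\<close> are frozen; the
  section exists where the frame does.\<close>

lemma distribution_local_section:
  fixes D :: "'a::euclidean_space \<Rightarrow> 'a set"
  assumes "distribution D" "z \<in> D p"
  obtains U Z where "open U" "p \<in> U" "smooth_on U Z" "Z p = z" "\<And>q. q \<in> U \<Longrightarrow> Z q \<in> D q"
proof -
  obtain k U s where p: "p \<in> U" and s: "frame_on k D U s"
    using assms unfolding smooth_subbundle_iff by blast
  have U: "open U" using s by (simp add: frame_on_def)
  have sq: "inj_on (\<lambda>i. s i q) {..<k}" "span ((\<lambda>i. s i q) ` {..<k}) = D q" if "q \<in> U" for q
    using s that by (auto simp: frame_on_def)
  have "z \<in> span ((\<lambda>i. s i p) ` {..<k})" using sq(2)[OF p] assms(2) by simp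
  then obtain c where "z = (\<Sum>v\<in>(\<lambda>i. s i p) ` {..<k}. c v *\<^sub>R v)"
    by (auto simp: span_finite)
  then have z: "z = (\<Sum>i<k. c (s i p) *\<^sub>R s i p)"
    using sq(1)[OF p] by (simp add: sum.reindex)
  show ?thesis
  proof (rule that[OF U p, of "\<lambda>q. \<Sum>i<k. c (s i p) *\<^sub>R s i q"])
    show "smooth_on U (\<lambda>q. \<Sum>i<k. c (s i p) *\<^sub>R s i q)"
      using s by (intro smooth_on_sum smooth_on_scaleR U smooth_on_const) (simp_all add: frame_on_def)
    show "(\<Sum>i<k. c (s i p) *\<^sub>R s i q) \<in> D q" if "q \<in> U" for q
      unfolding sq(2)[OF that, symmetric] by (intro span_sum span_scale span_base) auto
  qed (simp add: z)
qed

subsection \<open>The Poincare lemma for one-forms\<close>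

lemma bounded_linear_fd: "smooth f \<Longrightarrow> bounded_linear (fd f p)"
  by (rule has_derivative_bounded_linear[OF smooth_on_has_derivative[OF _ UNIV_I]])

text \<open>The potential is the integral of \<alpha> along the segment from the origin. Closedness
  makes the derivative of the integrand a total derivative in \<open>t\<close>.\<close>

lemma closed_one_form_exact:
  fixes \<alpha> :: "'a::euclidean_space \<Rightarrow> 'a \<Rightarrow>\<^sub>L real"
  assumes "closed_one_form \<alpha>"
  obtains K where "smooth K" "differential K = \<alpha>"
proof -
  have \<alpha>: "smooth \<alpha>"
    and closed: "blinfun_apply (fd \<alpha> p u) v = blinfun_apply (fd \<alpha> p v) u" for p u v
    using assms by (auto simp: closed_one_form_def)
  note \<alpha>' = smooth_on_has_derivative[OF \<alpha> UNIV_I]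
  \<comment> \<open>As a continuous operator-valued map, \<open>A\<close> makes the integrand
    \<open>fx\<close> jointly continuous, as differentiation under the integral requires.\<close>
  define A where "A y = Blinfun (fd \<alpha> y)" for y
  have A: "blinfun_apply (A y) = fd \<alpha> y" for y
    unfolding A_def by (rule bounded_linear_Blinfun_apply[OF bounded_linear_fd[OF \<alpha>]])
  have "smooth A"
    unfolding A_def
    by (intro smooth_on_Blinfun open_UNIV smooth_on_frechet_derivative[OF \<alpha>]
        bounded_linear.linear[OF bounded_linear_fd[OF \<alpha>]])
  then have contA: "continuous_on UNIV A" by (rule smooth_on_continuous_on)
  have cont\<alpha>: "continuous_on UNIV \<alpha>" using \<alpha> by (rule smooth_on_continuous_on)
  define fx where "fx x t = \<alpha> (t *\<^sub>R x) + t *\<^sub>R blinfun_apply (A (t *\<^sub>R x)) x" for x and t :: real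
  define K where "K x = integral (cbox 0 1) (\<lambda>t. blinfun_apply (\<alpha> (t *\<^sub>R x)) x)" for x
  have "(K has_derivative blinfun_apply (integral (cbox 0 1) (fx x))) (at x)" for x
    unfolding K_def
  proof (rule leibniz_rule[where U = UNIV, simplified])
    show "((\<lambda>x. blinfun_apply (\<alpha> (t *\<^sub>R x)) x) has_derivative blinfun_apply (fx x t)) (at x)" for x t
    proof -
      have "((\<lambda>x. t *\<^sub>R x) has_derivative (\<lambda>v. t *\<^sub>R v)) (at x)"
        by (auto intro!: derivative_eq_intros)
      from has_derivative_compose[OF this \<alpha>']
      have "((\<lambda>x. \<alpha> (t *\<^sub>R x)) has_derivative (\<lambda>v. fd \<alpha> (t *\<^sub>R x) (t *\<^sub>R v))) (at x)" .
      from bounded_bilinear.FDERIV[OF bounded_bilinear_blinfun_apply this has_derivative_ident]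
      have "((\<lambda>x. blinfun_apply (\<alpha> (t *\<^sub>R x)) x) has_derivative
          (\<lambda>v. blinfun_apply (\<alpha> (t *\<^sub>R x)) v + blinfun_apply (fd \<alpha> (t *\<^sub>R x) (t *\<^sub>R v)) x)) (at x)" .
      \<comment> \<open>Closedness exchanges the direction \<open>v\<close> with the radial vector
        \<open>x\<close>.\<close>
      moreover have "blinfun_apply (fd \<alpha> (t *\<^sub>R x) (t *\<^sub>R v)) x
          = t * blinfun_apply (fd \<alpha> (t *\<^sub>R x) x) v" for v
        using closed[of "t *\<^sub>R x" "t *\<^sub>R v" x] by (simp add: blinfun.scaleR_right)
      ultimately show ?thesis
        by (simp add: fx_def A plus_blinfun.rep_eq scaleR_blinfun.rep_eq)
    qed
    show "(\<lambda>t. blinfun_apply (\<alpha> (t *\<^sub>R x)) x) integrable_on cbox 0 1" for x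
      by (intro integrable_continuous blinfun.continuous_on continuous_intros
          continuous_on_compose2[OF cont\<alpha>]) auto
    show "continuous_on (UNIV \<times> cbox 0 1) (\<lambda>(x, t). fx x t)"
      unfolding fx_def split_beta
      by (intro continuous_intros continuous_on_compose2[OF cont\<alpha>] continuous_on_compose2[OF contA]) auto
  qed
  moreover have "integral (cbox 0 1) (fx x) = \<alpha> x" for x
  proof -
    \<comment> \<open>The primitive vanishes at \<open>t = 0\<close> and equals
      \<open>\<alpha> x\<close> at \<open>t = 1\<close>.\<close>
    have "((\<lambda>t. t *\<^sub>R \<alpha> (t *\<^sub>R x)) has_vector_derivative fx x t) (at t within {0..1})" for t :: real
    proof -
      have "((\<lambda>t. t *\<^sub>R x) has_derivative (\<lambda>s. s *\<^sub>R x)) (at t within {0..1})"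
        by (auto intro!: derivative_eq_intros)
      from has_derivative_compose[OF this \<alpha>']
      have "((\<lambda>t. \<alpha> (t *\<^sub>R x)) has_derivative (\<lambda>s. s *\<^sub>R fd \<alpha> (t *\<^sub>R x) x)) (at t within {0..1})"
        by (simp add: linear_scale[OF bounded_linear.linear[OF bounded_linear_fd[OF \<alpha>]]])
      from has_derivative_scaleR[OF has_derivative_ident this]
      show ?thesis
        by (simp add: has_vector_derivative_def fx_def A scaleR_right_distrib add.commute mult.commute)
    qed
    from fundamental_theorem_of_calculus[OF zero_le_one this]
    show ?thesis by (simp add: integral_unique)
  qed
  ultimately have K: "(K has_derivative blinfun_apply (\<alpha> x)) (at x)" for x by simp
  show ?thesis
  proof
    show "smooth K"
      by (rule smooth_onI[OF open_UNIV K]) (intro smooth_on_blinfun_apply \<alpha> open_UNIV smooth_on_const)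
    show "differential K = \<alpha>"
    proof
      fix p
      show "differential K p = \<alpha> p"
        unfolding differential_def frechet_derivative_at[OF K, symmetric] by (rule blinfun_apply_inverse)
    qed
  qed
qed

subsection \<open>The Dirac structure of a distribution and a two-form\<close>

lemma subspace_dirac_of:
  assumes "distribution D"
  shows "subspace (dirac_of D \<omega> q)"
  using distribution_subspace[OF assms, of q]
  by (auto simp: subspace_def dirac_of_def annihilator_def zero_prod_def blinfun.diff_left
      blinfun.add_left blinfun.add_right blinfun.scaleR_left blinfun.scaleR_right)

lemma annihilator_orthogonal_frame:
  fixes D :: "'a::euclidean_space \<Rightarrow> 'a set"
  assumes "orthogonal_frame g" "D q = span (g ` {..<k})" "k \<le> i" "i < DIM('a)"
  shows "blinfun_inner_left (g i) \<in> annihilator D q"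
proof -
  have "orthogonal (g i) v" if "v \<in> D q" for v
    using that assms
    by (intro orthogonal_to_span[of v "g ` {..<k}"]) (auto simp: orthogonal_def orthogonal_frame_def)
  then show ?thesis
    by (auto simp: annihilator_def blinfun_inner_left.rep_eq orthogonal_def inner_commute)
qed

text \<open>
  An orthogonal frame \<open>g\<close> whose first \<open>k\<close> members span \<open>D\<close> splits \<open>L\<close> into the graph of \<open>\<omega>\<close> over
  \<open>g\<^sub>0, \<dots>, g\<^sub>k\<^sub>-\<^sub>1\<close> and the annihilator of \<open>D\<close>, which is dual to the remaining members.
\<close>

lemma dirac_of_frame:
  fixes D :: "'a::euclidean_space \<Rightarrow> 'a set"
  assumes D: "distribution D" and \<omega>: "smooth \<omega>" and g: "orthogonal_frame_on k D U g"
    and k: "k \<le> DIM('a)"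
  shows "frame_on DIM('a) (dirac_of D \<omega>) U
    (\<lambda>i q. if i < k then (g q i, blinfun_apply (\<omega> q) (g q i)) else (0, blinfun_inner_left (g q i)))"
    (is "frame_on _ _ _ ?t")
  unfolding frame_on_def
proof (intro conjI ballI allI impI)
  show U: "open U" using g by (simp add: orthogonal_frame_on_def)
  show "smooth_on U (?t i)" if "i < DIM('a)" for i
  proof -
    have "smooth_on U (\<lambda>q. g q i)" using g that by (simp add: orthogonal_frame_on_def)
    moreover have "smooth_on U \<omega>" using \<omega> smooth_on_subset by blast
    ultimately show ?thesis
      using U by (cases "i < k")
        (auto intro!: smooth_on_Pair smooth_on_blinfun_apply
          smooth_on_bounded_linear[OF bounded_linear_blinfun_inner_left])
  qed
  fix q assume "q \<in> U"
  then have orth: "orthogonal_frame (g q)" and span: "span (g q ` {..<k}) = D q"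
    using g by (auto simp: orthogonal_frame_on_def)
  let ?N = "{..<DIM('a)}"
  let ?g = "g q" and ?s = "\<lambda>i. ?t i q"
  have gg: "?g j \<bullet> ?g j \<noteq> 0" if "j \<in> ?N" for j
    using orth that by (auto simp: orthogonal_frame_def)
  have og: "?g i \<bullet> ?g j = 0" if "i \<in> ?N" "j \<in> ?N" "i \<noteq> j" for i j
    using orth that by (auto simp: orthogonal_frame_def)
  have indep: "c j = 0" if c: "(\<Sum>i\<in>?N. c i *\<^sub>R ?s i) = 0" and j: "j \<in> ?N" for c j
  proof -
    \<comment> \<open>Frame members from \<open>k\<close> on have zero vector part, so vector parts
      detect the coefficients below \<open>k\<close>; the covector parts then detect the
      others.\<close>
    have low: "c j = 0" if "j \<in> ?N" "j < k" for j
    proof -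
      have "(\<Sum>i\<in>?N. c i *\<^sub>R fst (?s i)) = 0"
        using arg_cong[OF c, of fst] by (simp add: fst_sum)
      moreover have "(\<Sum>i\<in>?N. c i *\<^sub>R fst (?s i)) = (\<Sum>i\<in>?N. (if i < k then c i else 0) *\<^sub>R ?g i)"
        by (intro sum.cong) auto
      ultimately have "(\<Sum>i\<in>?N. (if i < k then c i else 0) *\<^sub>R ?g i) \<bullet> ?g j = 0" by simp
      then show ?thesis
        using orthogonal_family_sum[of ?N j ?g "\<lambda>i. if i < k then c i else 0"] og gg[OF that(1)] that
        by simp
    qed
    have "(\<Sum>i\<in>?N. c i *\<^sub>R snd (?s i)) = 0"
      using arg_cong[OF c, of snd] by (simp add: snd_sum)
    moreover have "(\<Sum>i\<in>?N. c i *\<^sub>R snd (?s i)) = (\<Sum>i\<in>?N. c i *\<^sub>R blinfun_inner_left (?g i))"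
      using low by (intro sum.cong) auto
    ultimately have "blinfun_apply (\<Sum>i\<in>?N. c i *\<^sub>R blinfun_inner_left (?g i)) (?g j) = 0" by simp
    then have "?g j \<bullet> (\<Sum>i\<in>?N. c i *\<^sub>R ?g i) = 0"
      by (simp add: blinfun.sum_left blinfun.scaleR_left blinfun_inner_left.rep_eq inner_sum_right)
    then show "c j = 0"
      unfolding inner_commute[of "?g j"] using orthogonal_family_sum[of ?N j ?g c] og gg[OF j] j by simp
  qed
  show "inj_on ?s ?N" "independent (?s ` ?N)"
    using independent_family[of ?N ?s] indep by blast+
  show "span (?s ` ?N) = dirac_of D \<omega> q"
  proof
    have "?s i \<in> dirac_of D \<omega> q" if "i \<in> ?N" for i
    proof (cases "i < k")
      case True
      then have "?g i \<in> D q" unfolding span[symmetric] by (intro span_base) auto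
      with True show ?thesis by (simp add: dirac_of_def annihilator_def)
    next
      case False
      then show ?thesis
        using annihilator_orthogonal_frame[of "g q" D q k i] orth span that
          subspace_0[OF distribution_subspace[OF D]]
        by (simp add: dirac_of_def)
    qed
    then show "span (?s ` ?N) \<subseteq> dirac_of D \<omega> q"
      by (intro span_minimal subspace_dirac_of[OF D] image_subsetI)
    show "dirac_of D \<omega> q \<subseteq> span (?s ` ?N)"
    proof
      fix a assume a: "a \<in> dirac_of D \<omega> q"
      define v \<gamma> where "v = fst a" and "\<gamma> = snd a - blinfun_apply (\<omega> q) v"
      have v: "v \<in> D q" and \<gamma>: "\<gamma> \<in> annihilator D q"
        using a by (auto simp: dirac_of_def v_def \<gamma>_def)
      \<comment> \<open>Coordinates of \<open>v\<close> in the orthogonal frame, followed by those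
        of \<gamma> in the covectors \<open>blinfun_inner_left (?g j)\<close>.\<close>
      define c where "c j = (v \<bullet> ?g j) / (?g j \<bullet> ?g j)" for j
      define d where "d j = blinfun_apply \<gamma> (?g j) / (?g j \<bullet> ?g j)" for j
      have c0: "c j = 0" if "j \<in> ?N" "\<not> j < k" for j
      proof -
        have "blinfun_inner_left (?g j) \<in> annihilator D q"
          using annihilator_orthogonal_frame[of "g q" D q k j] orth span that by simp
        then show ?thesis
          using v by (simp add: c_def annihilator_def blinfun_inner_left.rep_eq)
      qed
      have d0: "d j = 0" if "j < k" for j
      proof -
        have "?g j \<in> D q" unfolding span[symmetric] using that by (intro span_base) auto
        then show ?thesis using \<gamma> by (simp add: d_def annihilator_def)
      qed
      have v_eq: "v = (\<Sum>j\<in>?N. c j *\<^sub>R ?g j)"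
        unfolding c_def by (rule orthogonal_frame_expansion[OF orth])
      have \<gamma>_eq: "\<gamma> = (\<Sum>j\<in>?N. d j *\<^sub>R blinfun_inner_left (?g j))"
      proof (rule blinfun_eqI)
        fix x
        have "blinfun_apply \<gamma> x
            = blinfun_apply \<gamma> (\<Sum>j\<in>?N. ((x \<bullet> ?g j) / (?g j \<bullet> ?g j)) *\<^sub>R ?g j)"
          using orthogonal_frame_expansion[OF orth, of x] by simp
        also have "\<dots> = (\<Sum>j\<in>?N. d j * (x \<bullet> ?g j))"
          by (simp add: blinfun.sum_right blinfun.scaleR_right d_def mult.commute)
        finally show "blinfun_apply \<gamma> x
            = blinfun_apply (\<Sum>j\<in>?N. d j *\<^sub>R blinfun_inner_left (?g j)) x"
          by (simp add: blinfun.sum_left blinfun.scaleR_left blinfun_inner_left.rep_eq)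
      qed
      \<comment> \<open>\<open>c\<close> vanishes from \<open>k\<close> on and \<open>d\<close>
        vanishes below \<open>k\<close>, so their sum holds both sets of coordinates.\<close>
      have "a = (\<Sum>j\<in>?N. (c j + d j) *\<^sub>R ?s j)"
      proof (rule prod_eqI)
        have "fst (\<Sum>j\<in>?N. (c j + d j) *\<^sub>R ?s j) = (\<Sum>j\<in>?N. c j *\<^sub>R ?g j)"
          unfolding fst_sum by (rule sum.cong) (auto simp: c0 d0)
        then show "fst a = fst (\<Sum>j\<in>?N. (c j + d j) *\<^sub>R ?s j)"
          using v_eq by (simp add: v_def)
        have "snd (\<Sum>j\<in>?N. (c j + d j) *\<^sub>R ?s j)
            = (\<Sum>j\<in>?N. c j *\<^sub>R blinfun_apply (\<omega> q) (?g j) + d j *\<^sub>R blinfun_inner_left (?g j))"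
          unfolding snd_sum by (rule sum.cong) (auto simp: c0 d0)
        also have "\<dots> = blinfun_apply (\<omega> q) v + \<gamma>"
          unfolding v_eq \<gamma>_eq by (simp add: sum.distrib blinfun.sum_right blinfun.scaleR_right)
        finally show "snd a = snd (\<Sum>j\<in>?N. (c j + d j) *\<^sub>R ?s j)"
          by (simp add: \<gamma>_def)
      qed
      then show "a \<in> span (?s ` ?N)"
        by (simp only:) (intro span_sum span_scale span_base imageI)
    qed
  qed
qed

text \<open>The rank is \<open>DIM('a)\<close> whatever the rank of \<open>D\<close>: frame members
  outside \<open>D\<close> contribute a covector instead of a vector.\<close>

lemma smooth_subbundle_dirac_of:
  fixes D :: "'a::euclidean_space \<Rightarrow> 'a set"
  assumes "distribution D" "smooth \<omega>"
  shows "smooth_subbundle (dirac_of D \<omega>)"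
proof -
  obtain k where frame: "\<forall>p. \<exists>U s. p \<in> U \<and> frame_on k D U s"
    using assms unfolding smooth_subbundle_iff by blast
  have "\<exists>V t. p \<in> V \<and> frame_on DIM('a) (dirac_of D \<omega>) V t" for p
  proof -
    obtain U s where "frame_on k D U s" "p \<in> U" using frame by blast
    then obtain V g where "p \<in> V" "orthogonal_frame_on k D V g" "k \<le> DIM('a)"
      by (rule frame_on_imp_orthogonal_frame_on)
    then show ?thesis
      using dirac_of_frame[OF assms] by blast
  qed
  then show ?thesis unfolding smooth_subbundle_iff by blast
qed

section \<open>L as its own orthogonal complement\<close>

lemma two_form_skew:
  assumes "two_form \<omega>"
  shows "blinfun_apply (blinfun_apply (\<omega> p) u) v = - blinfun_apply (blinfun_apply (\<omega> p) v) u"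
proof -
  have "blinfun_apply (blinfun_apply (\<omega> p) w) w = 0" for w
    using assms by (simp add: two_form_def)
  from this[of "u + v"] this[of u] this[of v] show ?thesis
    by (simp add: blinfun.add_left blinfun.add_right)
qed

lemma annihilator_double:
  assumes "subspace (D p)" "\<And>\<gamma>. \<gamma> \<in> annihilator D p \<Longrightarrow> blinfun_apply \<gamma> v = 0"
  shows "v \<in> D p"
proof (rule mem_subspace_orthogonalI[OF assms(1)])
  fix y assume "\<And>w. w \<in> D p \<Longrightarrow> y \<bullet> w = 0"
  then have "blinfun_inner_left y \<in> annihilator D p"
    by (auto simp: annihilator_def blinfun_inner_left.rep_eq inner_commute)
  then show "y \<bullet> v = 0"
    using assms(2)[of "blinfun_inner_left y"] by (simp add: blinfun_inner_left.rep_eq inner_commute)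
qed

text \<open>Pairing two elements of L leaves a sum of two values of \<omega> that cancel by
  skewness. Conversely, the elements \<open>(0, \<gamma>)\<close> test the vector part through the
  double annihilator, and the elements \<open>(w, \<omega> w)\<close> test the covector
  part.\<close>

lemma almost_dirac_dirac_of:
  assumes D: "distribution D" and \<omega>: "two_form \<omega>"
  shows "almost_dirac (dirac_of D \<omega>)"
  unfolding almost_dirac_def
proof (intro conjI allI set_eqI iffI)
  show "smooth_subbundle (dirac_of D \<omega>)"
    using smooth_subbundle_dirac_of[OF D] \<omega> by (simp add: two_form_def)
  fix p a
  show "a \<in> {a. \<forall>b\<in>dirac_of D \<omega> p. courant_pairing a b = 0}" if a: "a \<in> dirac_of D \<omega> p"
  proof -
    have "blinfun_apply (snd b) (fst a) = blinfun_apply (blinfun_apply (\<omega> p) (fst b)) (fst a)"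
      if "a \<in> dirac_of D \<omega> p" "b \<in> dirac_of D \<omega> p" for a b
      using that by (auto simp: dirac_of_def annihilator_def blinfun.diff_left)
    then show ?thesis
      using a two_form_skew[OF \<omega>, of p "fst a"] by (auto simp: courant_pairing_def)
  qed
  assume "a \<in> {a. \<forall>b\<in>dirac_of D \<omega> p. courant_pairing a b = 0}"
  then have a: "courant_pairing a b = 0" if "b \<in> dirac_of D \<omega> p" for b
    using that by simp
  have 0: "0 \<in> D p" by (rule subspace_0[OF distribution_subspace[OF D]])
  have "fst a \<in> D p"
  proof (rule annihilator_double[OF distribution_subspace[OF D]])
    fix \<gamma> assume "\<gamma> \<in> annihilator D p"
    then have "(0, \<gamma>) \<in> dirac_of D \<omega> p" using 0 by (simp add: dirac_of_def)
    from a[OF this] show "blinfun_apply \<gamma> (fst a) = 0" by (simp add: courant_pairing_def)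
  qed
  moreover have "snd a - blinfun_apply (\<omega> p) (fst a) \<in> annihilator D p"
    unfolding annihilator_def
  proof (intro CollectI ballI)
    fix w assume "w \<in> D p"
    then have "(w, blinfun_apply (\<omega> p) w) \<in> dirac_of D \<omega> p"
      by (simp add: dirac_of_def annihilator_def)
    from a[OF this] show "blinfun_apply (snd a - blinfun_apply (\<omega> p) (fst a)) w = 0"
      using two_form_skew[OF \<omega>, of p w "fst a"] by (simp add: courant_pairing_def blinfun.diff_left)
  qed
  ultimately show "a \<in> dirac_of D \<omega> p" by (simp add: dirac_of_def case_prod_beta)
qed

section \<open>Closure of L under the Courant bracket\<close>

lemma blinfun_apply_has_derivative:
  assumes "(f has_derivative fd f p) (at p)" "(g has_derivative fd g p) (at p)"
  shows "((\<lambda>q. blinfun_apply (f q) (g q)) has_derivative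
    (\<lambda>u. blinfun_apply (f p) (fd g p u) + blinfun_apply (fd f p u) (g p))) (at p)"
  by (rule bounded_bilinear.FDERIV[OF bounded_bilinear_blinfun_apply assms])

text \<open>The product rule for the contraction of \<theta> with \<open>Z\<close>, which vanishes
  near \<open>p\<close>.\<close>

lemma derivative_annihilated:
  fixes \<theta> :: "'a::euclidean_space \<Rightarrow> 'a \<Rightarrow>\<^sub>L real"
  assumes \<theta>: "(\<theta> has_derivative fd \<theta> p) (at p)" "\<And>q. \<theta> q \<in> annihilator D q"
    and Z: "(Z has_derivative fd Z p) (at p)" "\<forall>\<^sub>F q in nhds p. Z q \<in> D q"
  shows "blinfun_apply (\<theta> p) (fd Z p u) + blinfun_apply (fd \<theta> p u) (Z p) = 0"
proof -
  obtain U where U: "open U" "p \<in> U" "\<And>q. q \<in> U \<Longrightarrow> Z q \<in> D q"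
    using Z(2) unfolding eventually_nhds by blast
  have "((\<lambda>q. 0) has_derivative
      (\<lambda>u. blinfun_apply (\<theta> p) (fd Z p u) + blinfun_apply (fd \<theta> p u) (Z p))) (at p)"
    by (rule has_derivative_transform_within_open[OF blinfun_apply_has_derivative[OF \<theta>(1) Z(1)] U(1,2)])
       (use \<theta>(2) U(3) in \<open>simp add: annihilator_def\<close>)
  from has_derivative_unique[OF this has_derivative_const] show ?thesis by (rule fun_cong)
qed

text \<open>Extend \<open>z\<close> to a local section \<open>Z\<close> of \<open>D\<close>: then \<open>d\<theta>(X, Z) = - \<theta>([X, Z]) = 0\<close>.\<close>

lemma annihilator_section_closed_on:
  fixes D :: "'a::euclidean_space \<Rightarrow> 'a set"
  assumes D: "distribution D" "integrable_distribution D"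
    and \<theta>: "smooth \<theta>" "\<And>q. \<theta> q \<in> annihilator D q"
    and X: "smooth X" "\<And>q. X q \<in> D q" and z: "z \<in> D p"
  shows "blinfun_apply (fd \<theta> p (X p)) z = blinfun_apply (fd \<theta> p z) (X p)"
proof -
  obtain U Z where U: "open U" "p \<in> U" and Z: "smooth_on U Z" "Z p = z" "\<And>q. q \<in> U \<Longrightarrow> Z q \<in> D q"
    using distribution_local_section[OF D(1) z] by blast
  note \<theta>' = smooth_on_has_derivative[OF \<theta>(1) UNIV_I]
  note X' = smooth_on_has_derivative[OF X(1) UNIV_I]
  note Z' = smooth_on_has_derivative[OF Z(1) U(2)]
  have evX: "\<forall>\<^sub>F q in nhds p. X q \<in> D q" using X(2) by simp
  have evZ: "\<forall>\<^sub>F q in nhds p. Z q \<in> D q"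
    using U Z(3) unfolding eventually_nhds by blast
  have "lie_bracket X Z p \<in> D p"
    by (rule integrable_distribution_involutive[OF D(2) X' evX Z' evZ])
  then have "blinfun_apply (\<theta> p) (lie_bracket X Z p) = 0"
    using \<theta>(2)[of p] by (simp add: annihilator_def)
  then show ?thesis
    using derivative_annihilated[OF \<theta>' \<theta>(2) X' evX, of z]
      derivative_annihilated[OF \<theta>' \<theta>(2) Z' evZ, of "X p"] Z(2)
    by (simp add: lie_bracket_def blinfun.diff_right)
qed

text \<open>Needed to bring the derivatives of \<omega> that the bracket produces into the cyclic
  order of \<open>closed_two_form\<close>.\<close>

lemma derivative_two_form_skew:
  assumes \<omega>: "two_form \<omega>"
  shows "blinfun_apply (blinfun_apply (fd \<omega> p u) v) w = - blinfun_apply (blinfun_apply (fd \<omega> p u) w) v"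
proof -
  have s: "smooth \<omega>" using \<omega> by (simp add: two_form_def)
  have d: "((\<lambda>q. blinfun_apply (blinfun_apply (\<omega> q) a) b) has_derivative
      (\<lambda>u. blinfun_apply (blinfun_apply (fd \<omega> p u) a) b)) (at p)" for a b
    using bounded_linear.has_derivative[OF bounded_linear_compose[OF
          blinfun.bounded_linear_left blinfun.bounded_linear_left] smooth_on_has_derivative[OF s UNIV_I]] .
  have "(\<lambda>q. blinfun_apply (blinfun_apply (\<omega> q) v) w) = (\<lambda>q. - blinfun_apply (blinfun_apply (\<omega> q) w) v)"
    using two_form_skew[OF \<omega>] by blast
  with d[of v w] have "((\<lambda>q. - blinfun_apply (blinfun_apply (\<omega> q) w) v) has_derivative
      (\<lambda>u. blinfun_apply (blinfun_apply (fd \<omega> p u) v) w)) (at p)"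
    by simp
  from has_derivative_unique[OF this has_derivative_minus[OF d[of w v]]]
  show ?thesis by (rule fun_cong)
qed

lemma dirac_of_courant_bracket:
  fixes D :: "'a::euclidean_space \<Rightarrow> 'a set"
  assumes D: "distribution D" "integrable_distribution D" and \<omega>: "closed_two_form \<omega>"
    and a: "is_section (dirac_of D \<omega>) a" and b: "is_section (dirac_of D \<omega>) b"
  shows "courant_bracket a b p \<in> dirac_of D \<omega> p"
proof -
  define X \<xi> Y \<eta> where XY: "X = fst \<circ> a" "\<xi> = snd \<circ> a" "Y = fst \<circ> b" "\<eta> = snd \<circ> b"
  have two: "two_form \<omega>" and sm\<omega>: "smooth \<omega>" using \<omega> by (auto simp: closed_two_form_def two_form_def)
  have sa: "smooth a" and sb: "smooth b" using a b by (auto simp: is_section_def)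
  have sm: "smooth X" "smooth \<xi>" "smooth Y" "smooth \<eta>"
    using smooth_on_bounded_linear[OF bounded_linear_fst open_UNIV sa]
      smooth_on_bounded_linear[OF bounded_linear_snd open_UNIV sa]
      smooth_on_bounded_linear[OF bounded_linear_fst open_UNIV sb]
      smooth_on_bounded_linear[OF bounded_linear_snd open_UNIV sb]
    by (simp_all add: XY o_def)
  note der = smooth_on_has_derivative[OF _ UNIV_I]
  have XD: "X q \<in> D q" and YD: "Y q \<in> D q" for q
    using a b by (auto simp: XY is_section_def dirac_of_def case_prod_beta)
  define \<theta> where "\<theta> q = \<xi> q - blinfun_apply (\<omega> q) (X q)" for q
  define \<tau> where "\<tau> q = \<eta> q - blinfun_apply (\<omega> q) (Y q)" for q
  have \<theta>D: "\<theta> q \<in> annihilator D q" and \<tau>D: "\<tau> q \<in> annihilator D q" for q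
    using a b by (auto simp: \<theta>_def \<tau>_def XY is_section_def dirac_of_def case_prod_beta)
  have sm\<theta>: "smooth \<theta>" and sm\<tau>: "smooth \<tau>"
    unfolding \<theta>_def \<tau>_def by (intro smooth_on_diff smooth_on_blinfun_apply open_UNIV sm sm\<omega>)+
  have d\<theta>: "fd \<theta> p u = fd \<xi> p u - (blinfun_apply (\<omega> p) (fd X p u) + blinfun_apply (fd \<omega> p u) (X p))" for u
    using frechet_derivative_at[OF has_derivative_diff[OF der[OF sm(2)]
          blinfun_apply_has_derivative[OF der[OF sm\<omega>] der[OF sm(1)]]], of p]
    unfolding \<theta>_def[abs_def] by (rule fun_cong[OF sym])
  have d\<tau>: "fd \<tau> p u = fd \<eta> p u - (blinfun_apply (\<omega> p) (fd Y p u) + blinfun_apply (fd \<omega> p u) (Y p))" for u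
    using frechet_derivative_at[OF has_derivative_diff[OF der[OF sm(4)]
          blinfun_apply_has_derivative[OF der[OF sm\<omega>] der[OF sm(3)]]], of p]
    unfolding \<tau>_def[abs_def] by (rule fun_cong[OF sym])
  define h where "h q = blinfun_apply (\<xi> q) (Y q) - blinfun_apply (\<eta> q) (X q)" for q
  have h': "(h has_derivative (\<lambda>u. blinfun_apply (\<xi> p) (fd Y p u) + blinfun_apply (fd \<xi> p u) (Y p)
      - (blinfun_apply (\<eta> p) (fd X p u) + blinfun_apply (fd \<eta> p u) (X p)))) (at p)"
    unfolding h_def
    by (intro has_derivative_diff blinfun_apply_has_derivative der sm)
  have dh: "blinfun_apply (differential h p) u
      = blinfun_apply (\<xi> p) (fd Y p u) + blinfun_apply (fd \<xi> p u) (Y p)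
      - (blinfun_apply (\<eta> p) (fd X p u) + blinfun_apply (fd \<eta> p u) (X p))" for u
    unfolding differential_def frechet_derivative_at[OF h', symmetric]
    by (rule fun_cong[OF bounded_linear_Blinfun_apply[OF has_derivative_bounded_linear[OF h']]])
  have bracket: "courant_bracket a b p = (lie_bracket X Y p,
      lie_derivative X \<eta> p - lie_derivative Y \<xi> p + (1/2) *\<^sub>R differential h p)"
    by (simp add: courant_bracket_def Let_def XY h_def[abs_def])
  have "lie_bracket X Y p \<in> D p"
    by (rule integrable_distribution_involutive[OF D(2) der[OF sm(1)] _ der[OF sm(3)]])
       (simp_all add: XD YD)
  moreover have "blinfun_apply (snd (courant_bracket a b p) - blinfun_apply (\<omega> p) (lie_bracket X Y p)) z = 0"
    if z: "z \<in> D p" for z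
  proof -
    have ev: "\<forall>\<^sub>F q in nhds p. X q \<in> D q" "\<forall>\<^sub>F q in nhds p. Y q \<in> D q"
      by (simp_all add: XD YD)
    note facts =
      derivative_annihilated[OF der[OF sm\<theta>] \<theta>D der[OF sm(3)] ev(2), of z]
      derivative_annihilated[OF der[OF sm\<tau>] \<tau>D der[OF sm(1)] ev(1), of z]
      derivative_annihilated[OF der[OF sm\<theta>] \<theta>D der[OF sm(1)] ev(1), of z]
      derivative_annihilated[OF der[OF sm\<tau>] \<tau>D der[OF sm(3)] ev(2), of z]
      annihilator_section_closed_on[OF D sm\<theta> \<theta>D sm(3) YD z]
      annihilator_section_closed_on[OF D sm\<tau> \<tau>D sm(1) XD z]
    have closed: "blinfun_apply (blinfun_apply (fd \<omega> p (X p)) (Y p)) z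
        + blinfun_apply (blinfun_apply (fd \<omega> p (Y p)) z) (X p)
        + blinfun_apply (blinfun_apply (fd \<omega> p z) (X p)) (Y p) = 0"
      using \<omega> by (simp add: closed_two_form_def)
    \<comment> \<open>After \<xi> and \<eta> are split, derivatives of \<open>X\<close> and
      \<open>Y\<close> along each other form the bracket and cancel against the subtracted term.
      Those along \<open>z\<close> cancel by skewness against the half differential, which also
      supplies the third term of the cyclic sum of \<omega>. The terms in \<theta> and \<tau> vanish
      by \<open>facts\<close>.\<close>
    show ?thesis
      using facts closed derivative_two_form_skew[OF two, of p "Y p" z "X p"]
        derivative_two_form_skew[OF two, of p z "X p" "Y p"]
        two_form_skew[OF two, of p "fd X p z" "Y p"] two_form_skew[OF two, of p "fd Y p z" "X p"]
      unfolding d\<theta> d\<tau> \<theta>_def[of p] \<tau>_def[of p] bracket lie_bracket_def snd_conv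
      by (simp add: blinfun.diff_left blinfun.diff_right blinfun.add_left blinfun.scaleR_left
          lie_derivative_apply[OF sm(1,4)] lie_derivative_apply[OF sm(3,2)] dh field_simps)
  qed
  ultimately show ?thesis
    by (simp add: bracket dirac_of_def annihilator_def)
qed

lemma dirac_structure_dirac_of:
  assumes "distribution D" "integrable_distribution D" "closed_two_form \<omega>"
  shows "dirac_structure (dirac_of D \<omega>)"
  unfolding dirac_structure_def
proof (intro conjI allI impI)
  show "almost_dirac (dirac_of D \<omega>)"
    using assms by (simp add: almost_dirac_dirac_of closed_two_form_def)
  fix a b assume "is_section (dirac_of D \<omega>) a \<and> is_section (dirac_of D \<omega>) b"
  then show "is_section (dirac_of D \<omega>) (courant_bracket a b)"
    using dirac_of_courant_bracket[OF assms] smooth_courant_bracket[of a b] unfolding is_section_def by blast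
qed

lemma hamiltonian_dirac_of:
  assumes "is_section D S" "closed_one_form \<alpha>"
    and "is_section (annihilator D) (\<lambda>p. \<alpha> p - interior_product S \<omega> p)"
  shows "hamiltonian (dirac_of D \<omega>) S"
proof -
  obtain K where "smooth K" "differential K = \<alpha>"
    using closed_one_form_exact[OF assms(2)] .
  moreover have "is_section (dirac_of D \<omega>) (\<lambda>p. (S p, \<alpha> p))"
    using assms
    by (simp add: is_section_def dirac_of_def interior_product_def closed_one_form_def smooth_on_Pair)
  ultimately show ?thesis unfolding hamiltonian_def by blast
qed

lemma constant_of_motion_if_annihilated:
  assumes "is_section D S" "two_form \<omega>"
    and "is_section (annihilator D) (\<lambda>p. \<alpha> p - interior_product S \<omega> p)"
    and "smooth H" "differential H = \<alpha>"
  shows "constant_of_motion S H"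
  unfolding constant_of_motion_def
proof
  fix p
  have "directional S H p = blinfun_apply (\<alpha> p) (S p)"
    unfolding directional_def assms(5)[symmetric]
    by (simp add: differential_apply[OF smooth_on_has_derivative[OF assms(4) UNIV_I]])
  \<comment> \<open>The subtracted term is \<omega> evaluated twice on \<open>S p\<close>, hence
    zero.\<close>
  also have "\<dots> = blinfun_apply (\<alpha> p - interior_product S \<omega> p) (S p)"
    using assms(2) by (simp add: blinfun.diff_left interior_product_def two_form_def)
  also have "\<dots> = 0"
    using assms(1,3) by (simp add: is_section_def annihilator_def)
  finally show "directional S H p = 0" .
qed

theorem theorem3p3:
  fixes S :: "'n::finite tangent_space \<Rightarrow> 'n tangent_space"
    and D :: "'n tangent_space \<Rightarrow> 'n tangent_space set"
    and \<omega> :: "'n tangent_space \<Rightarrow> 'n tangent_space \<Rightarrow>\<^sub>L 'n tangent_space \<Rightarrow>\<^sub>L real"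
    and \<alpha> :: "'n tangent_space \<Rightarrow> 'n tangent_space \<Rightarrow>\<^sub>L real"
  assumes "semispray S"
    and "distribution D"
    and "is_section D S"
    and "two_form \<omega>"
    and "closed_one_form \<alpha>"
    and "is_section (annihilator D) (\<lambda>p. \<alpha> p - interior_product S \<omega> p)"
  shows "(\<forall>H. smooth H \<and> differential H = \<alpha> \<longrightarrow> constant_of_motion S H) \<and>
    (integrable_distribution D \<and> closed_two_form \<omega> \<longrightarrow>
       dirac_structure (dirac_of D \<omega>) \<and> hamiltonian (dirac_of D \<omega>) S)"
  using constant_of_motion_if_annihilated[OF assms(3,4,6)] dirac_structure_dirac_of[OF assms(2)]
    hamiltonian_dirac_of[OF assms(3,5,6)]
  by blast

end
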